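(* Let $\mathcal{A}$ be the arrangement of $11$ planes in $\mathbb{P}^3_{\mathbb{C}}$ (homogeneous coordinates $x,y,z,w$) defined by $$f=(w+x-3y+5z)\,w\,x\,y\,(x-y-z)(x-y+z)(2x+y-2z)(x+3y-3z)(3x+2y+3z)(x+5y+5z)(7x-4y-z)=0.$$ Then the realization space $\mathcal{R}(\mathcal{A},\mathbb{C})$ of arrangements with the same intersection lattice as $\mathcal{A}$ is (isomorphic to) a Zariski-dense open subset of the affine space $\mathbb{A}^5_{\mathbb{C}}$.
   Context: Let $M=(E,\mathcal{B}(M))$ be a rank $n$ matroid on a ground set $E$ with $|E|=d$ and set of bases $\mathcal{B}(M)$. A realization of $M$ over a field $\mathbb{F}$ is an arrangement of hyperplanes $\{H_i\}_{i\in E}$ in $\mathbb{P}^{n-1}_{\mathbb{F}}$ such that $\mathcal{B}(M)=\{\lambda\subseteq E : |\lambda|=n,\ \bigcap_{i\in\lambda}H_i=\emptyset\}$. Representing $H_i$ by its normal vector $v_i\in\mathbb{P}^{n-1}_{\mathbb{F}}$, the set of realizations is the Zariski locally closed subset $$\widetilde{\mathcal{R}}(M;\mathbb{F})=\{(v_i)_{i\in E}\in(\mathbb{P}^{n-1}_{\mathbb{F}})^d : \text{for all }\lambda\subseteq E,\ |\lambda|=n:\ \det(A_\lambda)\neq0\iff\lambda\in\mathcal{B}(M)\},$$ where $A_\lambda$ is the $n\times n$ matrix whose columns are representatives in $\mathbb{F}^n$ of the $v_i$, $i\in\lambda$. The realization space of $M$ is the quotient $\mathcal{R}(M;\mathbb{F})=\widetilde{\mathcal{R}}(M;\mathbb{F})/\mathrm{PGL}(n,\mathbb{F})$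 by the natural diagonal action; it parametrizes all realizations of $M$ up to projective equivalence. For the arrangement $\mathcal{A}=\{H_1,\dots,H_{11}\}$ of planes in $\mathbb{P}^3_{\mathbb{C}}$, $\mathcal{R}(\mathcal{A},\mathbb{C})$ denotes $\mathcal{R}(M;\mathbb{C})$ for the rank $4$ matroid $M$ on $\{1,\dots,11\}$ realized by $\mathcal{A}$, i.e. with bases the $4$-subsets $\lambda$ such that $\bigcap_{i\in\lambda}H_i=\emptyset$. *)

theory Defs
  imports "HOL-Analysis.Analysis"
begin

section \<open>Complex varieties as spaces with functions\<close>

text \<open>
  A variety is represented by its (Zariski) topology together with, for every open set, the
  regular functions on it.  Functions are total in HOL; membership in \<open>regular X V\<close> only
  constrains the values on \<open>V\<close>.
\<close>

record 'p space_with_functions =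
  topol :: "'p topology"
  regular :: "'p set \<Rightarrow> ('p \<Rightarrow> complex) set"

definition isomorphism ::
  "'p space_with_functions \<Rightarrow> 'q space_with_functions \<Rightarrow> ('p \<Rightarrow> 'q) \<Rightarrow> bool" where
  "isomorphism X Y \<phi> \<longleftrightarrow>
     homeomorphic_map (topol X) (topol Y) \<phi> \<and>
     (\<forall>V f. openin (topol Y) V \<longrightarrow>
        (f \<in> regular Y V \<longleftrightarrow> f \<circ> \<phi> \<in> regular X {p \<in> topspace (topol X). \<phi> p \<in> V}))"

definition isomorphic ::
  "'p space_with_functions \<Rightarrow> 'q space_with_functions \<Rightarrow> bool" where
  "isomorphic X Y \<longleftrightarrow> (\<exists>\<phi>. isomorphism X Y \<phi>)"

text \<open>The quotient by an equivalence relation: quotient topology, and a function is regular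
  iff its pullback along the projection is regular, i.e. it is an invariant regular function.\<close>

definition quotient_space ::
  "'p space_with_functions \<Rightarrow> ('p \<times> 'p) set \<Rightarrow> 'p set space_with_functions" where
  "quotient_space X r =
     \<lparr> topol = topology (\<lambda>U. U \<subseteq> topspace (topol X) // r \<and> openin (topol X) (\<Union>U)),
       regular = (\<lambda>V. {f. (\<lambda>p. f (r `` {p})) \<in> regular X (\<Union>V)}) \<rparr>"

lemma openin_quotient_space:
  assumes r: "equiv (topspace (topol X)) r"
  shows "openin (topol (quotient_space X r)) U \<longleftrightarrow>
           U \<subseteq> topspace (topol X) // r \<and> openin (topol X) (\<Union>U)"
proof -
  have int: "\<Union>(S \<inter> T) = \<Union>S \<inter> \<Union>T"
    if "S \<subseteq> topspace (topol X) // r" "T \<subseteq> topspace (topol X) // r" for S T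
    using that quotient_disj[OF r] by blast
  have "istopology (\<lambda>U. U \<subseteq> topspace (topol X) // r \<and> openin (topol X) (\<Union>U))"
    unfolding istopology_def
  proof (intro conjI allI impI)
    fix S T
    assume "S \<subseteq> topspace (topol X) // r \<and> openin (topol X) (\<Union>S)"
      and "T \<subseteq> topspace (topol X) // r \<and> openin (topol X) (\<Union>T)"
    then show "S \<inter> T \<subseteq> topspace (topol X) // r" "openin (topol X) (\<Union>(S \<inter> T))"
      using int by auto
  next
    fix K
    assume K: "\<forall>S\<in>K. S \<subseteq> topspace (topol X) // r \<and> openin (topol X) (\<Union>S)"
    then show "\<Union>K \<subseteq> topspace (topol X) // r" by blast
    have "\<Union>(\<Union>K) = (\<Union>S\<in>K. \<Union>S)" by blast
    then show "openin (topol X) (\<Union>(\<Union>K))" using K by auto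
  qed
  then show ?thesis
    by (simp add: quotient_space_def topology_inverse')
qed

section \<open>Polynomial functions and Zariski topologies\<close>

text \<open>The algebra of functions generated by a set \<open>G\<close> of coordinate functions.  Over the
  infinite field of complex numbers these are the polynomials in the coordinates.\<close>

inductive_set polynomial_functions :: "('x \<Rightarrow> complex) set \<Rightarrow> ('x \<Rightarrow> complex) set"
  for G where
  const: "(\<lambda>x. c) \<in> polynomial_functions G"
| coord: "g \<in> G \<Longrightarrow> g \<in> polynomial_functions G"
| add: "\<lbrakk>f \<in> polynomial_functions G; h \<in> polynomial_functions G\<rbrakk>
         \<Longrightarrow> (\<lambda>x. f x + h x) \<in> polynomial_functions G"
| mult: "\<lbrakk>f \<in> polynomial_functions G; h \<in> polynomial_functions G\<rbrakk>
         \<Longrightarrow> (\<lambda>x. f x * h x) \<in> polynomial_functions G"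

text \<open>The topology on \<open>X\<close> whose closed sets are the intersections of members of \<open>N\<close>, the zero
  loci of single functions.\<close>

definition zariski_topology :: "'p set \<Rightarrow> 'p set set \<Rightarrow> 'p topology" where
  "zariski_topology X N = topology (\<lambda>U. \<exists>Z\<subseteq>N. U = X - \<Inter>Z)"

lemma openin_zariski_topology:
  assumes un: "\<And>A B. A \<in> N \<Longrightarrow> B \<in> N \<Longrightarrow> A \<union> B \<in> N"
  shows "openin (zariski_topology X N) U \<longleftrightarrow> (\<exists>Z\<subseteq>N. U = X - \<Inter>Z)"
proof -
  have "istopology (\<lambda>U. \<exists>Z\<subseteq>N. U = X - \<Inter>Z)"
    unfolding istopology_def
  proof (intro conjI allI impI)
    fix S T
    assume "\<exists>Z\<subseteq>N. S = X - \<Inter>Z" and "\<exists>Z\<subseteq>N. T = X - \<Inter>Z"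
    then obtain Z Z' where Z: "Z \<subseteq> N" "S = X - \<Inter>Z" "Z' \<subseteq> N" "T = X - \<Inter>Z'" by blast
    have "S \<inter> T = X - \<Inter>{A \<union> B | A B. A \<in> Z \<and> B \<in> Z'}"
      unfolding Z by blast
    moreover have "{A \<union> B | A B. A \<in> Z \<and> B \<in> Z'} \<subseteq> N" using Z un by blast
    ultimately show "\<exists>Z\<subseteq>N. S \<inter> T = X - \<Inter>Z" by blast
  next
    fix K
    assume "\<forall>S\<in>K. \<exists>Z\<subseteq>N. S = X - \<Inter>Z"
    then obtain z where z: "\<And>S. S \<in> K \<Longrightarrow> z S \<subseteq> N \<and> S = X - \<Inter>(z S)" by metis
    have "\<Union>K = (\<Union>S\<in>K. X - \<Inter>(z S))" using z by blast
    also have "\<dots> = X - \<Inter>(\<Union>(z ` K))" by blast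
    finally show "\<exists>Z\<subseteq>N. \<Union>K = X - \<Inter>Z" using z by (metis UN_least)
  qed
  then show ?thesis
    by (simp add: zariski_topology_def topology_inverse')
qed

subsection \<open>Affine space\<close>

definition affine_polys :: "(complex ^ 'n \<Rightarrow> complex) set" where
  "affine_polys = polynomial_functions (range (\<lambda>i x. x $ i))"

definition affine_zariski :: "(complex ^ 'n) topology" where
  "affine_zariski = zariski_topology UNIV {{x. f x = 0} | f. f \<in> affine_polys}"

lemma openin_affine_zariski:
  "openin affine_zariski U \<longleftrightarrow>
     (\<exists>F\<subseteq>affine_polys. U = UNIV - {x :: complex ^ 'n. \<forall>f\<in>F. f x = 0})"
proof -
  let ?N = "{{x :: complex ^ 'n. f x = 0} | f. f \<in> affine_polys}"
  have "A \<union> B \<in> ?N" if "A \<in> ?N" "B \<in> ?N" for A B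
  proof -
    from that obtain f g where fg: "f \<in> affine_polys" "g \<in> affine_polys"
      and AB: "A = {x. f x = 0}" "B = {x. g x = 0}" by blast
    have "(\<lambda>x. f x * g x) \<in> affine_polys"
      using fg by (simp add: affine_polys_def polynomial_functions.mult)
    moreover have "A \<union> B = {x. f x * g x = 0}" using AB by auto
    ultimately show ?thesis by (intro CollectI exI[of _ "\<lambda>x. f x * g x"]) simp
  qed
  then have *: "openin affine_zariski U \<longleftrightarrow> (\<exists>Z\<subseteq>?N. U = UNIV - \<Inter>Z)"
    unfolding affine_zariski_def by (rule openin_zariski_topology)
  have N: "?N = (\<lambda>f. {x. f x = 0}) ` affine_polys" by (rule Setcompr_eq_image)
  have I: "\<Inter>((\<lambda>f. {x. f x = 0}) ` F) = {x :: complex ^ 'n. \<forall>f\<in>F. f x = 0}" for F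
    by (simp add: INTER_eq)
  show ?thesis
  proof
    assume "openin affine_zariski U"
    then obtain Z where Z: "Z \<subseteq> (\<lambda>f. {x. f x = 0}) ` affine_polys" "U = UNIV - \<Inter>Z"
      unfolding * N by blast
    from Z(1) obtain F where F: "F \<subseteq> affine_polys" "Z = (\<lambda>f. {x. f x = 0}) ` F"
      by (rule subset_imageE)
    have "U = UNIV - {x. \<forall>f\<in>F. f x = 0}" unfolding Z(2) F(2) I ..
    with F(1) show "\<exists>F\<subseteq>affine_polys. U = UNIV - {x. \<forall>f\<in>F. f x = 0}"
      by (intro exI[of _ F] conjI)
  next
    assume "\<exists>F\<subseteq>affine_polys. U = UNIV - {x. \<forall>f\<in>F. f x = 0}"
    then obtain F where F: "F \<subseteq> affine_polys" "U = UNIV - {x. \<forall>f\<in>F. f x = 0}"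
      by (elim exE conjE)
    show "openin affine_zariski U"
      unfolding * N
      by (intro exI[of _ "(\<lambda>f. {x. f x = 0}) ` F"] conjI image_mono F(1)) (simp only: F(2) I)
  qed
qed

definition affine_subspace :: "(complex ^ 'n) set \<Rightarrow> (complex ^ 'n) space_with_functions" where
  "affine_subspace S =
     \<lparr> topol = subtopology affine_zariski S,
       regular = (\<lambda>V. {f. \<forall>p\<in>V. \<exists>W. openin (subtopology affine_zariski S) W \<and> p \<in> W \<and> W \<subseteq> V \<and>
         (\<exists>a\<in>affine_polys. \<exists>b\<in>affine_polys. \<forall>x\<in>W. b x \<noteq> 0 \<and> f x = a x / b x)}) \<rparr>"

subsection \<open>Products of projective spaces\<close>

definition proj_space :: "(complex ^ 'n) set set" where
  "proj_space = {vec.span {x} | x. x \<noteq> 0}"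

definition proj_power :: "'e set \<Rightarrow> ('e \<Rightarrow> (complex ^ 'n) set) set" where
  "proj_power E = (\<Pi>\<^sub>E e\<in>E. proj_space)"

definition represents ::
  "'e set \<Rightarrow> ('e \<Rightarrow> complex ^ 'n) \<Rightarrow> ('e \<Rightarrow> (complex ^ 'n) set) \<Rightarrow> bool" where
  "represents E v L \<longleftrightarrow> (\<forall>e\<in>E. v e \<noteq> 0 \<and> L e = vec.span {v e})"

text \<open>Multihomogeneous polynomials of multidegree \<open>d\<close> in the coordinates of the \<open>v e\<close>, for
  finite \<open>E\<close>.\<close>

definition multihomogeneous ::
  "'e set \<Rightarrow> ('e \<Rightarrow> nat) \<Rightarrow> (('e \<Rightarrow> complex ^ 'n) \<Rightarrow> complex) set" where
  "multihomogeneous E d =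
     {f \<in> polynomial_functions {\<lambda>v. v e $ i | e i. e \<in> E}.
        \<forall>c v. f (\<lambda>e. c e *s v e) = (\<Prod>e\<in>E. c e ^ d e) * f v}"

definition proj_zero_locus ::
  "'e set \<Rightarrow> (('e \<Rightarrow> complex ^ 'n) \<Rightarrow> complex) \<Rightarrow> ('e \<Rightarrow> (complex ^ 'n) set) set" where
  "proj_zero_locus E f = {L \<in> proj_power E. \<forall>v. represents E v L \<longrightarrow> f v = 0}"

definition proj_zariski :: "'e set \<Rightarrow> ('e \<Rightarrow> (complex ^ 'n) set) topology" where
  "proj_zariski E =
     zariski_topology (proj_power E) {proj_zero_locus E f | f d. f \<in> multihomogeneous E d}"

lemma multihomogeneous_mult:
  assumes "f \<in> multihomogeneous E d" "g \<in> multihomogeneous E d'"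
  shows "(\<lambda>v. f v * g v) \<in> multihomogeneous E (\<lambda>e. d e + d' e)"
  using assms
  by (auto simp: multihomogeneous_def power_add prod.distrib intro: polynomial_functions.mult)

lemma represents_rescale:
  fixes v w :: "'e \<Rightarrow> complex ^ 'n"
  assumes "represents E v L" "represents E w L"
  obtains c where "\<And>e. c e \<noteq> 0" "\<And>e. e \<in> E \<Longrightarrow> w e = c e *s v e"
proof -
  have "\<exists>c. c \<noteq> 0 \<and> (e \<in> E \<longrightarrow> w e = c *s v e)" for e
  proof (cases "e \<in> E")
    case True
    then have "w e \<in> vec.span {v e}" "w e \<noteq> 0"
      using assms by (auto simp: represents_def intro: vec.span_base)
    then obtain c where "w e = c *s v e" by (auto simp: vec.span_singleton)
    with \<open>w e \<noteq> 0\<close> show ?thesis by (intro exI[of _ c]) auto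
  qed (auto intro: exI[of _ 1])
  then show ?thesis using that by metis
qed

lemma polynomial_functions_cong:
  assumes "f \<in> polynomial_functions {\<lambda>v. v e $ i | e i. e \<in> E}"
    and "\<And>e. e \<in> E \<Longrightarrow> v e = w e"
  shows "f v = f w"
  using assms by (induction) auto

lemma multihomogeneous_zero_iff:
  fixes f :: "('e \<Rightarrow> complex ^ 'n) \<Rightarrow> complex"
  assumes f: "f \<in> multihomogeneous E d" and vw: "represents E v L" "represents E w L"
  shows "f v = 0 \<longleftrightarrow> f w = 0"
proof -
  obtain c where c: "\<And>e. c e \<noteq> 0" "\<And>e. e \<in> E \<Longrightarrow> w e = c e *s v e"
    using represents_rescale[OF vw] by blast
  have "f w = f (\<lambda>e. c e *s v e)"
  proof (rule polynomial_functions_cong)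
    show "f \<in> polynomial_functions {\<lambda>v. v e $ i | e i. e \<in> E}"
      using f unfolding multihomogeneous_def mem_Collect_eq by (rule conjunct1)
  qed (rule c(2))
  also have "\<dots> = (\<Prod>e\<in>E. c e ^ d e) * f v"
    using f by (simp add: multihomogeneous_def)
  finally show ?thesis using c(1) by (cases "finite E") auto
qed

lemma openin_proj_zariski:
  "openin (proj_zariski E) U \<longleftrightarrow>
     (\<exists>Z \<subseteq> {proj_zero_locus E f | f d. f \<in> multihomogeneous E d}.
        U = proj_power E - (\<Inter>Z :: ('e \<Rightarrow> (complex ^ 'n) set) set))"
  unfolding proj_zariski_def
proof (rule openin_zariski_topology)
  fix A B :: "('e \<Rightarrow> (complex ^ 'n) set) set"
  assume "A \<in> {proj_zero_locus E f | f d. f \<in> multihomogeneous E d}"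
    and "B \<in> {proj_zero_locus E f | f d. f \<in> multihomogeneous E d}"
  then obtain f d g d' where fg: "f \<in> multihomogeneous E d" "g \<in> multihomogeneous E d'"
    and AB: "A = proj_zero_locus E f" "B = proj_zero_locus E g" by blast
  have "A \<union> B = proj_zero_locus E (\<lambda>v. f v * g v)"
  proof (rule set_eqI)
    fix L :: "'e \<Rightarrow> (complex ^ 'n) set"
    have "(\<forall>v. represents E v L \<longrightarrow> f v * g v = 0) \<longleftrightarrow>
        (\<forall>v. represents E v L \<longrightarrow> f v = 0) \<or> (\<forall>v. represents E v L \<longrightarrow> g v = 0)"
      using multihomogeneous_zero_iff[OF fg(1)] multihomogeneous_zero_iff[OF fg(2)]
        mult_eq_0_iff[of "f _" "g _"] by meson
    then show "L \<in> A \<union> B \<longleftrightarrow> L \<in> proj_zero_locus E (\<lambda>v. f v * g v)"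
      unfolding AB proj_zero_locus_def by blast
  qed
  then show "A \<union> B \<in> {proj_zero_locus E f | f d. f \<in> multihomogeneous E d}"
    using multihomogeneous_mult[OF fg] by blast
qed

definition proj_subspace ::
  "'e set \<Rightarrow> ('e \<Rightarrow> (complex ^ 'n) set) set \<Rightarrow> ('e \<Rightarrow> (complex ^ 'n) set) space_with_functions"
where
  "proj_subspace E S =
     \<lparr> topol = subtopology (proj_zariski E) S,
       regular = (\<lambda>V. {f. \<forall>p\<in>V. \<exists>W. openin (subtopology (proj_zariski E) S) W \<and> p \<in> W \<and> W \<subseteq> V \<and>
         (\<exists>d. \<exists>a\<in>multihomogeneous E d. \<exists>b\<in>multihomogeneous E d.
            \<forall>L\<in>W. \<forall>v. represents E v L \<longrightarrow> b v \<noteq> 0 \<and> f L = a v / b v)}) \<rparr>"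

section \<open>Realization spaces\<close>

text \<open>A matroid on \<open>E\<close> of rank \<open>CARD('n)\<close> is given by its set \<open>B\<close> of bases.  In the determinant
  the columns are listed by an arbitrary bijection \<open>b\<close> from the column indices onto \<open>l\<close>; the
  nonvanishing depends neither on \<open>b\<close> nor on the representatives \<open>v\<close>.\<close>

definition realizations :: "'e set \<Rightarrow> 'e set set \<Rightarrow> ('e \<Rightarrow> (complex ^ 'n) set) set" where
  "realizations E B =
     {L \<in> proj_power E. \<forall>l \<subseteq> E. card l = CARD('n) \<longrightarrow>
        (\<forall>v b. represents E v L \<and> bij_betw b (UNIV :: 'n set) l \<longrightarrow>
           (det (\<chi> i j. v (b j) $ i) \<noteq> 0 \<longleftrightarrow> l \<in> B))}"

text \<open>Orbits under \<open>PGL\<close>, whose elements are the classes of invertible matrices modulo the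
  scalars, which act trivially.\<close>

definition projective_equivalence ::
  "'e set \<Rightarrow> 'e set set \<Rightarrow> (('e \<Rightarrow> (complex ^ 'n) set) \<times> ('e \<Rightarrow> (complex ^ 'n) set)) set" where
  "projective_equivalence E B =
     {(L, L'). L \<in> realizations E B \<and> L' \<in> realizations E B \<and>
        (\<exists>A :: complex ^ 'n ^ 'n. invertible A \<and> (\<forall>e\<in>E. L' e = (*v) A ` L e))}"

definition realization_space ::
  "'e set \<Rightarrow> 'e set set \<Rightarrow> ('e \<Rightarrow> (complex ^ 'n) set) set space_with_functions" where
  "realization_space E B =
     quotient_space (proj_subspace E (realizations E B)) (projective_equivalence E B)"

lemma topspace_proj_subspace_realizations:
  "topspace (topol (proj_subspace E (realizations E B))) =
     (realizations E B :: ('e \<Rightarrow> (complex ^ 'n) set) set)"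
proof -
  let ?one = "(\<lambda>v. 1) :: ('e \<Rightarrow> complex ^ 'n) \<Rightarrow> complex"
  have one: "?one \<in> multihomogeneous E (\<lambda>_. 0)"
    by (simp add: multihomogeneous_def polynomial_functions.const)
  have "\<exists>v. represents E v L" if "L \<in> proj_power E" for L :: "'e \<Rightarrow> (complex ^ 'n) set"
  proof -
    have "\<exists>x. x \<noteq> 0 \<and> L e = vec.span {x}" if "e \<in> E" for e
      using \<open>L \<in> proj_power E\<close> that by (auto simp: proj_power_def proj_space_def)
    then show ?thesis unfolding represents_def by metis
  qed
  then have "proj_zero_locus E ?one = {}" by (auto simp: proj_zero_locus_def)
  then have "openin (proj_zariski E) (proj_power E :: ('e \<Rightarrow> (complex ^ 'n) set) set)"
    unfolding openin_proj_zariski using one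
    by (intro exI[of _ "{proj_zero_locus E ?one}"]) auto
  then have "proj_power E \<subseteq> topspace (proj_zariski E :: ('e \<Rightarrow> (complex ^ 'n) set) topology)"
    by (rule openin_subset)
  moreover have "realizations E B \<subseteq> (proj_power E :: ('e \<Rightarrow> (complex ^ 'n) set) set)"
    by (auto simp: realizations_def)
  ultimately show ?thesis by (auto simp: proj_subspace_def)
qed

lemma equiv_projective_equivalence:
  "equiv (realizations E B :: ('e \<Rightarrow> (complex ^ 'n) set) set) (projective_equivalence E B)"
proof (rule equivI)
  show "projective_equivalence E B \<subseteq>
      (realizations E B :: ('e \<Rightarrow> (complex ^ 'n) set) set) \<times> realizations E B"
    by (auto simp: projective_equivalence_def)
  show "refl_on (realizations E B :: ('e \<Rightarrow> (complex ^ 'n) set) set) (projective_equivalence E B)"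
  proof (rule refl_onI)
    fix L :: "'e \<Rightarrow> (complex ^ 'n) set"
    assume L: "L \<in> realizations E B"
    have "invertible (mat 1 :: complex ^ 'n ^ 'n)" by (auto simp: invertible_def)
    moreover have "\<forall>e\<in>E. L e = (*v) (mat 1 :: complex ^ 'n ^ 'n) ` L e" by simp
    ultimately show "(L, L) \<in> projective_equivalence E B"
      using L unfolding projective_equivalence_def by blast
  qed
  show "sym (projective_equivalence E B :: (('e \<Rightarrow> (complex ^ 'n) set) \<times> _) set)"
  proof (rule symI)
    fix L L' :: "'e \<Rightarrow> (complex ^ 'n) set"
    assume "(L, L') \<in> projective_equivalence E B"
    then obtain A :: "complex ^ 'n ^ 'n" where LL: "L \<in> realizations E B" "L' \<in> realizations E B"
      and A: "invertible A" "\<forall>e\<in>E. L' e = (*v) A ` L e"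
      by (auto simp: projective_equivalence_def)
    from A(1) obtain A' where A': "A ** A' = mat 1" "A' ** A = mat 1"
      by (auto simp: invertible_def)
    then have "invertible A'" by (auto simp: invertible_def)
    moreover have "\<forall>e\<in>E. L e = (*v) A' ` L' e"
      using A(2) A' by (simp add: image_image matrix_vector_mul_assoc)
    ultimately show "(L', L) \<in> projective_equivalence E B"
      using LL by (auto simp: projective_equivalence_def)
  qed
  show "trans (projective_equivalence E B :: (('e \<Rightarrow> (complex ^ 'n) set) \<times> _) set)"
  proof (rule transI)
    fix L L' L'' :: "'e \<Rightarrow> (complex ^ 'n) set"
    assume "(L, L') \<in> projective_equivalence E B" "(L', L'') \<in> projective_equivalence E B"
    then obtain A A' :: "complex ^ 'n ^ 'n"
      where LL: "L \<in> realizations E B" "L'' \<in> realizations E B"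
      and A: "invertible A" "\<forall>e\<in>E. L' e = (*v) A ` L e"
      and A': "invertible A'" "\<forall>e\<in>E. L'' e = (*v) A' ` L' e"
      by (auto simp: projective_equivalence_def)
    have "invertible (A' ** A)" using A(1) A'(1) by (rule invertible_mult[rotated])
    moreover have "\<forall>e\<in>E. L'' e = (*v) (A' ** A) ` L e"
      using A(2) A'(2) by (simp add: image_image matrix_vector_mul_assoc)
    ultimately show "(L, L'') \<in> projective_equivalence E B"
      using LL unfolding projective_equivalence_def by blast
  qed
qed

section \<open>Arrangements and their matroids\<close>

definition hyperplane :: "(complex ^ 'n \<Rightarrow> complex) \<Rightarrow> (complex ^ 'n) set set" where
  "hyperplane f = {P \<in> proj_space. \<forall>p\<in>P. f p = 0}"

definition arrangement_bases ::
  "'e set \<Rightarrow> ('e \<Rightarrow> (complex ^ 'n) set set) \<Rightarrow> 'e set set" where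
  "arrangement_bases E H = {l. l \<subseteq> E \<and> card l = CARD('n) \<and> (\<Inter>i\<in>l. H i) = {}}"

definition factors :: "(complex \<Rightarrow> complex \<Rightarrow> complex \<Rightarrow> complex \<Rightarrow> complex) list" where
  "factors =
     [\<lambda>x y z w. w + x - 3*y + 5*z,
      \<lambda>x y z w. w,
      \<lambda>x y z w. x,
      \<lambda>x y z w. y,
      \<lambda>x y z w. x - y - z,
      \<lambda>x y z w. x - y + z,
      \<lambda>x y z w. 2*x + y - 2*z,
      \<lambda>x y z w. x + 3*y - 3*z,
      \<lambda>x y z w. 3*x + 2*y + 3*z,
      \<lambda>x y z w. x + 5*y + 5*z,
      \<lambda>x y z w. 7*x - 4*y - z]"

definition \<A> :: "nat \<Rightarrow> (complex ^ 4) set set" where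
  "\<A> i = hyperplane (\<lambda>p. (factors ! (i - 1)) (p $ 1) (p $ 2) (p $ 3) (p $ 4))"

end

theory Submission
  imports Defs
begin

text \<open>
  The linear group moves the points 3, 4, 5, 6 of the dual configuration to a standard
  frame of the plane spanned by 3, ..., 11, and the homologies and elations fixing that plane
  pointwise put 2, and 1 on its line through 2, in standard position.  All other coordinates are
  then polynomials in five parameters, and the equations imposed by the non-bases hold identically,
  so the normal forms are parametrized by the locus in affine space where finitely many polynomials
  do not vanish.  Conversely the parameters are invariant quotients of products of determinants.
  Hence the normal form is a polynomial section of a regular invariant map.
\<close>

section \<open>Quotients with a polynomial section\<close>

text \<open>The number five is a count. The ten points of the dual plane, namely 3 to 11 and the
  trace of the line through 1 and 2, have 20 degrees of freedom; a frame takes 8 and the seven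
  collinearities take 7. These collinearities leave no relation among the parameters because the
  points can be placed one after another so that each lies on at most two lines spanned by earlier
  ones. The homologies and elations form a four-dimensional group, used up by the three coordinates
  of 2 and the position of 1 on its line. Matching dimensions would not yet describe the quotient:
  its topology consists of saturated open sets and its functions are the invariant ones, so both
  have to be compared with the affine ones, in one direction along the invariant map and in the
  other along the section. The open set is never computed: its openness rests on the finiteness of
  the set of bases, and its nonemptiness on the given arrangement, which has a normal form
  itself.\<close>

lemma polynomial_functions_uminus:
  "f \<in> polynomial_functions G \<Longrightarrow> (\<lambda>x. - f x) \<in> polynomial_functions G"
  using polynomial_functions.mult[OF polynomial_functions.const[of "-1"]] by fastforce

lemma polynomial_functions_diff:
  "f \<in> polynomial_functions G \<Longrightarrow> h \<in> polynomial_functions G \<Longrightarrow>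
    (\<lambda>x. f x - h x) \<in> polynomial_functions G"
  using polynomial_functions.add[OF _ polynomial_functions_uminus] by fastforce

lemma polynomial_functions_prod:
  "(\<And>i. i \<in> I \<Longrightarrow> f i \<in> polynomial_functions G) \<Longrightarrow>
    (\<lambda>x. \<Prod>i\<in>I. f i x) \<in> polynomial_functions G"
  by (induction I rule: infinite_finite_induct)
     (simp_all add: polynomial_functions.const polynomial_functions.mult)

lemma polynomial_functions_sum:
  "(\<And>i. i \<in> I \<Longrightarrow> f i \<in> polynomial_functions G) \<Longrightarrow>
    (\<lambda>x. \<Sum>i\<in>I. f i x) \<in> polynomial_functions G"
  by (induction I rule: infinite_finite_induct)
     (simp_all add: polynomial_functions.const polynomial_functions.add)

lemma multihomogeneous_add:
  assumes "f \<in> multihomogeneous E d" "g \<in> multihomogeneous E d"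
  shows "(\<lambda>v. f v + g v) \<in> multihomogeneous E d"
  using assms
  by (auto simp: multihomogeneous_def distrib_left intro: polynomial_functions.add)

lemma multihomogeneous_const: "(\<lambda>v. c) \<in> multihomogeneous E (\<lambda>_. 0)"
  by (simp add: multihomogeneous_def polynomial_functions.const)

text \<open>Regular functions on the projective side are quotients of equal multidegree. A sum is
  brought over the product of the two denominators, which keeps the degrees equal and the
  denominator nonzero on \<open>S\<close>.\<close>

lemma pullback_affine_poly:
  fixes a b :: "'m::finite \<Rightarrow> ('e \<Rightarrow> complex ^ 'n) \<Rightarrow> complex"
  assumes f: "f \<in> affine_polys"
    and ab: "\<And>i. a i \<in> multihomogeneous E (d i)" "\<And>i. b i \<in> multihomogeneous E (d i)"
    and \<Phi>: "\<And>L v i. L \<in> S \<Longrightarrow> represents E v L \<Longrightarrow> b i v \<noteq> 0 \<and> \<Phi> L $ i = a i v / b i v"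
  obtains d' g h where "g \<in> multihomogeneous E d'" "h \<in> multihomogeneous E d'"
    "\<And>L v. L \<in> S \<Longrightarrow> represents E v L \<Longrightarrow> h v \<noteq> 0 \<and> f (\<Phi> L) = g v / h v"
proof -
  have "\<exists>d' g h. g \<in> multihomogeneous E d' \<and> h \<in> multihomogeneous E d' \<and>
    (\<forall>L v. L \<in> S \<longrightarrow> represents E v L \<longrightarrow> h v \<noteq> 0 \<and> f (\<Phi> L) = g v / h v)"
    using f unfolding affine_polys_def
  proof induction
    case (const c)
    show ?case
      by (intro exI[of _ "\<lambda>_. 0"] exI[of _ "\<lambda>_. c"] exI[of _ "\<lambda>_. 1"])
         (simp add: multihomogeneous_const)
  next
    case (coord p)
    then obtain i where "p = (\<lambda>x. x $ i)" by blast
    then show ?case using ab \<Phi>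
      by (intro exI[of _ "d i"] exI[of _ "a i"] exI[of _ "b i"]) simp
  next
    case (add p q)
    then obtain d1 g1 h1 d2 g2 h2 where
      1: "g1 \<in> multihomogeneous E d1" "h1 \<in> multihomogeneous E d1"
      "\<And>L v. L \<in> S \<Longrightarrow> represents E v L \<Longrightarrow> h1 v \<noteq> 0 \<and> p (\<Phi> L) = g1 v / h1 v" and
      2: "g2 \<in> multihomogeneous E d2" "h2 \<in> multihomogeneous E d2"
      "\<And>L v. L \<in> S \<Longrightarrow> represents E v L \<Longrightarrow> h2 v \<noteq> 0 \<and> q (\<Phi> L) = g2 v / h2 v"
      by (elim exE conjE) blast
    have "(\<lambda>v. g1 v * h2 v + h1 v * g2 v) \<in> multihomogeneous E (\<lambda>e. d1 e + d2 e)"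
      "(\<lambda>v. h1 v * h2 v) \<in> multihomogeneous E (\<lambda>e. d1 e + d2 e)"
      using 1 2 by (auto intro!: multihomogeneous_add multihomogeneous_mult)
    then show ?case using 1(3) 2(3)
      by (intro exI[of _ "\<lambda>e. d1 e + d2 e"] exI[of _ "\<lambda>v. g1 v * h2 v + h1 v * g2 v"]
            exI[of _ "\<lambda>v. h1 v * h2 v"])
         (simp add: add_frac_eq mult.commute)
  next
    case (mult p q)
    then obtain d1 g1 h1 d2 g2 h2 where
      1: "g1 \<in> multihomogeneous E d1" "h1 \<in> multihomogeneous E d1"
      "\<And>L v. L \<in> S \<Longrightarrow> represents E v L \<Longrightarrow> h1 v \<noteq> 0 \<and> p (\<Phi> L) = g1 v / h1 v" and
      2: "g2 \<in> multihomogeneous E d2" "h2 \<in> multihomogeneous E d2"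
      "\<And>L v. L \<in> S \<Longrightarrow> represents E v L \<Longrightarrow> h2 v \<noteq> 0 \<and> q (\<Phi> L) = g2 v / h2 v"
      by (elim exE conjE) blast
    have "(\<lambda>v. g1 v * g2 v) \<in> multihomogeneous E (\<lambda>e. d1 e + d2 e)"
      "(\<lambda>v. h1 v * h2 v) \<in> multihomogeneous E (\<lambda>e. d1 e + d2 e)"
      using 1 2 by (auto intro!: multihomogeneous_mult)
    then show ?case using 1(3) 2(3)
      by (intro exI[of _ "\<lambda>e. d1 e + d2 e"] exI[of _ "\<lambda>v. g1 v * g2 v"]
            exI[of _ "\<lambda>v. h1 v * h2 v"]) simp
  qed
  then show ?thesis using that by metis
qed

text \<open>The tool for the way back: with polynomial representatives \<open>s x\<close> inserted,
  forms on the projective side become polynomials in the parameters.\<close>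

lemma pullback_multihomogeneous:
  fixes s :: "complex ^ 'm \<Rightarrow> 'e \<Rightarrow> complex ^ 'n"
  assumes "g \<in> multihomogeneous E d"
    and s: "\<And>e j. e \<in> E \<Longrightarrow> (\<lambda>x. s x e $ j) \<in> affine_polys"
  shows "(\<lambda>x. g (s x)) \<in> affine_polys"
proof -
  have "g \<in> polynomial_functions {\<lambda>v. v e $ i | e i. e \<in> E}"
    using assms(1) by (simp add: multihomogeneous_def)
  then show ?thesis
  proof induction
    case (coord g)
    then obtain e i where "e \<in> E" "g = (\<lambda>v. v e $ i)" by blast
    then show ?case using s by simp
  qed (auto simp: affine_polys_def intro: polynomial_functions.intros)
qed

section \<open>Zariski open sets tested at representatives\<close>

lemma openin_proj_subspace:
  "openin (topol (proj_subspace E S)) W \<longleftrightarrow>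
     (\<exists>F. (\<forall>f\<in>F. \<exists>d. f \<in> multihomogeneous E d) \<and>
        W = S \<inter> (proj_power E - (\<Inter>f\<in>F. proj_zero_locus E f)))"
  (is "?lhs \<longleftrightarrow> ?rhs")
proof
  assume ?lhs
  then obtain Z where Z: "Z \<subseteq> {proj_zero_locus E f | f d. f \<in> multihomogeneous E d}"
    "W = (proj_power E - \<Inter>Z) \<inter> S"
    by (auto simp: proj_subspace_def openin_subtopology openin_proj_zariski)
  let ?F = "{f. (\<exists>d. f \<in> multihomogeneous E d) \<and> proj_zero_locus E f \<in> Z}"
  have "Z = proj_zero_locus E ` ?F" using Z(1) by blast
  then show ?rhs using Z(2) by (intro exI[of _ ?F]) auto
next
  assume ?rhs
  then obtain F where F: "\<forall>f\<in>F. \<exists>d. f \<in> multihomogeneous E d"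
     "W = S \<inter> (proj_power E - (\<Inter>f\<in>F. proj_zero_locus E f))" by blast
  then have "proj_zero_locus E ` F \<subseteq> {proj_zero_locus E f | f d. f \<in> multihomogeneous E d}"
    by blast
  then show ?lhs using F(2)
    by (auto simp: proj_subspace_def openin_subtopology openin_proj_zariski)
qed

text \<open>\<open>proj_zero_locus\<close> speaks of all representatives, but changing the
  representative multiplies a multihomogeneous function by a nonzero factor, so a single
  \<open>v\<close> decides.\<close>

lemma mem_open_proj_subspace:
  assumes "L \<in> proj_power E" "represents E v L" "\<And>f. f \<in> F \<Longrightarrow> \<exists>d. f \<in> multihomogeneous E d"
  shows "L \<in> proj_power E - (\<Inter>f\<in>F. proj_zero_locus E f) \<longleftrightarrow> (\<exists>f\<in>F. f v \<noteq> 0)"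
proof -
  have "L \<in> proj_zero_locus E f \<longleftrightarrow> f v = 0" if fF: "f \<in> F" for f
  proof -
    obtain d where f: "f \<in> multihomogeneous E d" using assms(3)[OF fF] by blast
    then show ?thesis
      unfolding proj_zero_locus_def mem_Collect_eq
      using assms(1,2) multihomogeneous_zero_iff[OF f] by blast
  qed
  then show ?thesis using assms(1) by blast
qed

lemma proj_power_represents:
  fixes L :: "'e \<Rightarrow> (complex ^ 'n) set"
  assumes "L \<in> proj_power E"
  obtains v where "represents E v L"
proof -
  have "\<exists>x. x \<noteq> 0 \<and> L e = vec.span {x}" if "e \<in> E" for e
    using assms that by (auto simp: proj_power_def proj_space_def)
  then show ?thesis using that unfolding represents_def by metis
qed

lemma topspace_affine_zariski: "topspace affine_zariski = (UNIV :: (complex ^ 'n) set)"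
proof -
  have "openin affine_zariski (UNIV :: (complex ^ 'n) set)"
    unfolding openin_affine_zariski
    by (intro exI[of _ "{\<lambda>_. 1}"]) (auto simp: affine_polys_def polynomial_functions.const)
  then show ?thesis using openin_subset by blast
qed

text \<open>Continuity and pullback of regular functions along \<open>\<Phi>\<close> come from its coordinates \<open>a i / b i\<close>,
  their converses from the polynomial section \<open>s\<close>.\<close>

lemma isomorphic_realization_space:
  fixes \<Phi> :: "('e \<Rightarrow> (complex ^ 'n) set) \<Rightarrow> complex ^ 'm"
    and s :: "complex ^ 'm \<Rightarrow> 'e \<Rightarrow> complex ^ 'n"
    and E :: "'e set" and B :: "'e set set"
  defines "S \<equiv> realizations E B :: ('e \<Rightarrow> (complex ^ 'n) set) set"
    and "r \<equiv> projective_equivalence E B :: (('e \<Rightarrow> (complex ^ 'n) set) \<times> _) set"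
    and "\<sigma> \<equiv> \<lambda>x. \<lambda>e\<in>E. vec.span {s x e}"
  assumes ab: "\<And>i. a i \<in> multihomogeneous E (d i)" "\<And>i. b i \<in> multihomogeneous E (d i)"
    and \<Phi>: "\<And>L v i. L \<in> S \<Longrightarrow> represents E v L \<Longrightarrow> b i v \<noteq> 0 \<and> \<Phi> L $ i = a i v / b i v"
    and inv: "\<And>L L'. (L, L') \<in> r \<Longrightarrow> \<Phi> L = \<Phi> L'"
    and s: "\<And>e j. e \<in> E \<Longrightarrow> (\<lambda>x. s x e $ j) \<in> affine_polys"
    and s0: "\<And>x e. x \<in> U \<Longrightarrow> e \<in> E \<Longrightarrow> s x e \<noteq> 0"
    and \<sigma>: "\<And>x. x \<in> U \<Longrightarrow> \<sigma> x \<in> S \<and> \<Phi> (\<sigma> x) = x"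
    and sec: "\<And>L. L \<in> S \<Longrightarrow> \<Phi> L \<in> U \<and> (L, \<sigma> (\<Phi> L)) \<in> r"
  shows "isomorphic (realization_space E B :: ('e \<Rightarrow> (complex ^ 'n) set) set space_with_functions)
    (affine_subspace U)"
proof -
  have S: "S \<subseteq> proj_power E" by (auto simp: S_def realizations_def)
  have topS: "topspace (topol (proj_subspace E S)) = S"
    unfolding S_def by (rule topspace_proj_subspace_realizations)
  have r: "equiv S r" unfolding S_def r_def by (rule equiv_projective_equivalence)
  define Q where "Q = quotient_space (proj_subspace E S) r"
  have Q: "realization_space E B = Q" by (simp add: Q_def realization_space_def S_def r_def)
  have openQ: "openin (topol Q) W \<longleftrightarrow> W \<subseteq> S // r \<and> openin (topol (proj_subspace E S)) (\<Union>W)" for W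
    unfolding Q_def using openin_quotient_space[of "proj_subspace E S" r] r topS by simp
  have topU: "topspace (topol (affine_subspace U)) = U"
    by (simp add: affine_subspace_def topspace_affine_zariski)
  have US: "\<Union>(S // r) = S" using r by (rule Union_quotient)
  have "openin (topol Q) (S // r)"
    unfolding openQ US using topS openin_topspace[of "topol (proj_subspace E S)"] by simp
  then have topQ: "topspace (topol Q) = S // r"
    using openin_subset openQ openin_topspace by blast
  \<comment> \<open>An arbitrary member of the class is taken; invariance of \<Phi> makes the choice
    harmless.\<close>
  define \<phi> where "\<phi> C = \<Phi> (SOME L. L \<in> C)" for C
  have \<phi>: "\<phi> C = \<Phi> L" if C: "C \<in> S // r" and L: "L \<in> C" for C L
  proof -
    have "(SOME L. L \<in> C) \<in> C" by (rule someI[of "\<lambda>L. L \<in> C", OF L])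
    then have "(SOME L. L \<in> C, L) \<in> r" using in_quotient_imp_in_rel[OF r C] L by blast
    then show ?thesis unfolding \<phi>_def by (rule inv)
  qed
  have cls: "r `` {L} \<in> S // r" "L \<in> r `` {L}" if "L \<in> S" for L
    using that equiv_class_self[OF r that] by (auto intro: quotientI)
  have \<phi>': "\<phi> (r `` {L}) = \<Phi> L" if "L \<in> S" for L using cls[OF that] by (rule \<phi>)
  \<comment> \<open>Openness and regularity in the quotient are read off from unions of classes;
    here such a union becomes a preimage under \<Phi>.\<close>
  have pre: "\<Union>{C \<in> S // r. \<phi> C \<in> V} = {L \<in> S. \<Phi> L \<in> V}" for V
  proof (intro equalityI subsetI)
    fix L assume "L \<in> \<Union>{C \<in> S // r. \<phi> C \<in> V}"
    then obtain C where "C \<in> S // r" "\<phi> C \<in> V" "L \<in> C" by blast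
    then show "L \<in> {L \<in> S. \<Phi> L \<in> V}" using \<phi>[of C L] US by auto
  next
    fix L assume "L \<in> {L \<in> S. \<Phi> L \<in> V}"
    then show "L \<in> \<Union>{C \<in> S // r. \<phi> C \<in> V}" using cls[of L] \<phi>'[of L] by auto
  qed
  have rep: "represents E (s x) (\<sigma> x)" if "x \<in> U" for x
    using s0 that by (simp add: represents_def \<sigma>_def)
  have pull_s: "(\<lambda>x. g (s x)) \<in> affine_polys" if "g \<in> multihomogeneous E d" for g d
    using that s by (rule pullback_multihomogeneous)
  have openPhi: "openin (topol (proj_subspace E S)) {L \<in> S. \<Phi> L \<in> V}"
    if V: "openin (topol (affine_subspace U)) V" for V
  proof -
    from V obtain F where F: "F \<subseteq> affine_polys" "V = (UNIV - {x. \<forall>f\<in>F. f x = 0}) \<inter> U"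
      by (auto simp: affine_subspace_def openin_subtopology openin_affine_zariski)
    have "\<exists>g d h. f \<in> F \<longrightarrow> g \<in> multihomogeneous E d \<and>
      (\<forall>L v. L \<in> S \<longrightarrow> represents E v L \<longrightarrow> h v \<noteq> 0 \<and> f (\<Phi> L) = g v / h v)" for f
    proof (cases "f \<in> F")
      case True
      then have "f \<in> affine_polys" using F(1) by blast
      then obtain d' g h where "g \<in> multihomogeneous E d'" "h \<in> multihomogeneous E d'"
        "\<And>L v. L \<in> S \<Longrightarrow> represents E v L \<Longrightarrow> h v \<noteq> 0 \<and> f (\<Phi> L) = g v / h v"
        by (rule pullback_affine_poly[OF _ ab \<Phi>]) auto
      then show ?thesis by blast
    qed auto
    then obtain g d h where g: "\<And>f. f \<in> F \<Longrightarrow> g f \<in> multihomogeneous E (d f)"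
      "\<And>f L v. f \<in> F \<Longrightarrow> L \<in> S \<Longrightarrow> represents E v L \<Longrightarrow> h f v \<noteq> 0 \<and> f (\<Phi> L) = g f v / h f v"
      by metis
    \<comment> \<open>The denominators vanish nowhere on \<open>S\<close>, so the numerators alone
      cut out the preimage.\<close>
    have "\<Phi> L \<in> V \<longleftrightarrow> L \<in> proj_power E - (\<Inter>f\<in>g ` F. proj_zero_locus E f)" if L: "L \<in> S" for L
    proof -
      have LP: "L \<in> proj_power E" using L S by blast
      then obtain v where v: "represents E v L" by (rule proj_power_represents)
      have "L \<in> proj_power E - (\<Inter>f\<in>g ` F. proj_zero_locus E f) \<longleftrightarrow> (\<exists>f\<in>g ` F. f v \<noteq> 0)"
        using LP v by (rule mem_open_proj_subspace) (use g(1) in blast)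
      also have "\<dots> \<longleftrightarrow> (\<exists>f\<in>F. f (\<Phi> L) \<noteq> 0)" proof -
        have "g f v \<noteq> 0 \<longleftrightarrow> f (\<Phi> L) \<noteq> 0" if "f \<in> F" for f using g(2)[OF that L v] by simp
        then show ?thesis by blast
      qed
      also have "\<dots> \<longleftrightarrow> \<Phi> L \<in> V" using F(2) sec[OF L] by auto
      finally show ?thesis by simp
    qed
    then have "{L \<in> S. \<Phi> L \<in> V} = S \<inter> (proj_power E - (\<Inter>f\<in>g ` F. proj_zero_locus E f))"
      by blast
    moreover have "\<forall>f\<in>g ` F. \<exists>d. f \<in> multihomogeneous E d" using g(1) by blast
    ultimately show ?thesis unfolding openin_proj_subspace by blast
  qed
  have opens: "openin (topol (affine_subspace U)) {x \<in> U. \<sigma> x \<in> W}"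
    if W: "openin (topol (proj_subspace E S)) W" for W
  proof -
    from W obtain F where F: "\<And>f. f \<in> F \<Longrightarrow> \<exists>d. f \<in> multihomogeneous E d"
      "W = S \<inter> (proj_power E - (\<Inter>f\<in>F. proj_zero_locus E f))"
      unfolding openin_proj_subspace by blast
    let ?F = "(\<lambda>f x. f (s x)) ` F"
    have "?F \<subseteq> affine_polys" using F(1) pull_s by blast
    then have "openin affine_zariski (UNIV - {x. \<forall>f\<in>?F. f x = 0})"
      unfolding openin_affine_zariski by blast
    moreover have "\<sigma> x \<in> W \<longleftrightarrow> (\<exists>f\<in>F. f (s x) \<noteq> 0)" if x: "x \<in> U" for x
      using mem_open_proj_subspace[OF _ rep[OF x] F(1)] \<sigma>[OF x] S unfolding F(2) by blast
    then have "{x \<in> U. \<sigma> x \<in> W} = U \<inter> (UNIV - {x. \<forall>f\<in>?F. f x = 0})" by auto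
    ultimately show ?thesis
      by (auto simp: affine_subspace_def openin_subtopology)
  qed
  have "homeomorphic_map (topol Q) (topol (affine_subspace U)) \<phi>"
  proof (rule bijective_open_imp_homeomorphic_map)
    have "\<phi> C \<in> U" if "C \<in> S // r" for C
      using that \<phi> sec US by (metis UnionI quotientE cls(2))
    then show "continuous_map (topol Q) (topol (affine_subspace U)) \<phi>"
      unfolding continuous_map_def topQ topU openQ pre using openPhi by blast
    show "open_map (topol Q) (topol (affine_subspace U)) \<phi>"
      unfolding open_map_def
    proof (intro allI impI)
      fix W assume "openin (topol Q) W"
      then have W: "W \<subseteq> S // r" "openin (topol (proj_subspace E S)) (\<Union>W)" by (auto simp: openQ)
      \<comment> \<open>The union of \<open>W\<close> is saturated, so the image under \<phi> is the
        preimage under \<sigma>: continuity of the section yields openness of \<phi>.\<close>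
      have "\<phi> ` W = {x \<in> U. \<sigma> x \<in> \<Union>W}"
      proof (intro equalityI subsetI)
        fix x assume "x \<in> \<phi> ` W"
        then obtain C where C: "C \<in> W" "x = \<phi> C" by blast
        then obtain L where L: "L \<in> S" "C = r `` {L}" using W(1) by (meson quotientE subsetD)
        then have "x = \<Phi> L" using C(2) \<phi>' by simp
        then show "x \<in> {x \<in> U. \<sigma> x \<in> \<Union>W}" using sec[OF L(1)] L(2) C(1) by auto
      next
        fix x assume x: "x \<in> {x \<in> U. \<sigma> x \<in> \<Union>W}"
        then obtain C where C: "C \<in> W" "\<sigma> x \<in> C" by blast
        then have "\<phi> C = x" using \<phi>[of C "\<sigma> x"] W(1) \<sigma> x by auto
        then show "x \<in> \<phi> ` W" using C(1) by blast
      qed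
      then show "openin (topol (affine_subspace U)) (\<phi> ` W)" using opens[OF W(2)] by simp
    qed
    show "\<phi> ` topspace (topol Q) = topspace (topol (affine_subspace U))"
      unfolding topQ topU
    proof (intro equalityI subsetI)
      fix x assume "x \<in> U"
      then have "x = \<phi> (r `` {\<sigma> x})" "\<sigma> x \<in> S" using \<sigma> \<phi>' by auto
      then show "x \<in> \<phi> ` (S // r)" using cls(1) by blast
    qed (use \<open>\<And>C. C \<in> S // r \<Longrightarrow> \<phi> C \<in> U\<close> in blast)
    show "inj_on \<phi> (topspace (topol Q))"
      unfolding topQ
    proof (rule inj_onI)
      fix C C' assume C: "C \<in> S // r" "C' \<in> S // r" "\<phi> C = \<phi> C'"
      then obtain L L' where L: "L \<in> S" "C = r `` {L}" "L' \<in> S" "C' = r `` {L'}"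
        by (meson quotientE)
      then have "\<Phi> L = \<Phi> L'" using C(3) \<phi>' by simp
      \<comment> \<open>Both are equivalent to the same value of the section, \<sigma> (\<Phi> L) =
        \<sigma> (\<Phi> L').\<close>
      then have "(L, L') \<in> r"
        using sec[OF L(1)] sec[OF L(3)] r by (metis equivE symE transE)
      then show "C = C'" unfolding L using r by (simp add: equiv_class_eq)
    qed
  qed
  moreover have "f \<in> regular (affine_subspace U) V \<longleftrightarrow>
      f \<circ> \<phi> \<in> regular Q {p \<in> topspace (topol Q). \<phi> p \<in> V}"
    if V: "openin (topol (affine_subspace U)) V" for V f
  proof -
    have VU: "V \<subseteq> U" using V openin_subset topU by blast
    have regQ: "f \<circ> \<phi> \<in> regular Q {p \<in> topspace (topol Q). \<phi> p \<in> V} \<longleftrightarrow>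
      (\<lambda>L. f (\<phi> (r `` {L}))) \<in> regular (proj_subspace E S) {L \<in> S. \<Phi> L \<in> V}"
      unfolding topQ by (simp add: pre Q_def quotient_space_def)
    have tU: "topol (affine_subspace U) = subtopology affine_zariski U"
      by (simp add: affine_subspace_def)
    have tS: "topol (proj_subspace E S) = subtopology (proj_zariski E) S"
      by (simp add: proj_subspace_def)
    show ?thesis
    proof
      assume f: "f \<in> regular (affine_subspace U) V"
      show "f \<circ> \<phi> \<in> regular Q {p \<in> topspace (topol Q). \<phi> p \<in> V}"
        unfolding regQ unfolding proj_subspace_def space_with_functions.simps mem_Collect_eq
      proof
        fix L assume L: "L \<in> {L \<in> S. \<Phi> L \<in> V}"
        then obtain W p q where W: "openin (subtopology affine_zariski U) W" "\<Phi> L \<in> W" "W \<subseteq> V"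
          and pq: "p \<in> affine_polys" "q \<in> affine_polys" "\<And>x. x \<in> W \<Longrightarrow> q x \<noteq> 0 \<and> f x = p x / q x"
          using f unfolding affine_subspace_def space_with_functions.simps mem_Collect_eq
          by (elim ballE[of _ _ "\<Phi> L"]) auto
        obtain d1 g1 h1 where 1: "g1 \<in> multihomogeneous E d1" "h1 \<in> multihomogeneous E d1"
          "\<And>L v. L \<in> S \<Longrightarrow> represents E v L \<Longrightarrow> h1 v \<noteq> 0 \<and> p (\<Phi> L) = g1 v / h1 v"
          by (rule pullback_affine_poly[OF pq(1) ab \<Phi>]) auto
        obtain d2 g2 h2 where 2: "g2 \<in> multihomogeneous E d2" "h2 \<in> multihomogeneous E d2"
          "\<And>L v. L \<in> S \<Longrightarrow> represents E v L \<Longrightarrow> h2 v \<noteq> 0 \<and> q (\<Phi> L) = g2 v / h2 v"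
          by (rule pullback_affine_poly[OF pq(2) ab \<Phi>]) auto
        let ?d = "\<lambda>e. d1 e + d2 e"
        show "\<exists>W. openin (subtopology (proj_zariski E) S) W \<and> L \<in> W \<and> W \<subseteq> {L \<in> S. \<Phi> L \<in> V} \<and>
           (\<exists>d. \<exists>a\<in>multihomogeneous E d. \<exists>b\<in>multihomogeneous E d.
             \<forall>L\<in>W. \<forall>v. represents E v L \<longrightarrow> b v \<noteq> 0 \<and> f (\<phi> (r `` {L})) = a v / b v)"
        proof (intro exI[of _ "{L \<in> S. \<Phi> L \<in> W}"] exI[of _ ?d] conjI)
          show "openin (subtopology (proj_zariski E) S) {L \<in> S. \<Phi> L \<in> W}"
            using openPhi W(1) unfolding tU tS by blast
          show "L \<in> {L \<in> S. \<Phi> L \<in> W}" "{L \<in> S. \<Phi> L \<in> W} \<subseteq> {L \<in> S. \<Phi> L \<in> V}"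
            using L W by auto
          \<comment> \<open>Dividing p = g1 / h1 by q = g2 / h2 gives this fraction; g2 is nonzero
            because q is, and both products have degree \<open>?d\<close>.\<close>
          have "h1 v * g2 v \<noteq> 0 \<and> f (\<phi> (r `` {L})) = g1 v * h2 v / (h1 v * g2 v)"
            if "L \<in> {L \<in> S. \<Phi> L \<in> W}" and v: "represents E v L" for L v
            using 1(3)[OF _ v] 2(3)[OF _ v] pq(3)[of "\<Phi> L"] \<phi>'[of L] that(1) by auto
          then have "\<forall>L\<in>{L \<in> S. \<Phi> L \<in> W}. \<forall>v. represents E v L \<longrightarrow>
              h1 v * g2 v \<noteq> 0 \<and> f (\<phi> (r `` {L})) = g1 v * h2 v / (h1 v * g2 v)"
            by blast
          then have "\<exists>b\<in>multihomogeneous E ?d.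
              \<forall>L\<in>{L \<in> S. \<Phi> L \<in> W}. \<forall>v. represents E v L \<longrightarrow>
                b v \<noteq> 0 \<and> f (\<phi> (r `` {L})) = g1 v * h2 v / b v"
            by (rule rev_bexI[OF multihomogeneous_mult[OF 1(2) 2(1)]])
          then show "\<exists>a\<in>multihomogeneous E ?d. \<exists>b\<in>multihomogeneous E ?d.
              \<forall>L\<in>{L \<in> S. \<Phi> L \<in> W}. \<forall>v. represents E v L \<longrightarrow>
                b v \<noteq> 0 \<and> f (\<phi> (r `` {L})) = a v / b v"
            by (rule rev_bexI[OF multihomogeneous_mult[OF 1(1) 2(2)]])
        qed
      qed
    next
      assume f: "f \<circ> \<phi> \<in> regular Q {p \<in> topspace (topol Q). \<phi> p \<in> V}"
      show "f \<in> regular (affine_subspace U) V"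
        unfolding affine_subspace_def space_with_functions.simps mem_Collect_eq
      proof
        fix x assume x: "x \<in> V"
        then have xU: "x \<in> U" using VU by blast
        then have "\<sigma> x \<in> {L \<in> S. \<Phi> L \<in> V}" using \<sigma> x by auto
        then obtain W d a b where W: "openin (subtopology (proj_zariski E) S) W" "\<sigma> x \<in> W"
          "W \<subseteq> {L \<in> S. \<Phi> L \<in> V}"
          and ab: "a \<in> multihomogeneous E d" "b \<in> multihomogeneous E d"
          and eq: "\<And>L v. L \<in> W \<Longrightarrow> represents E v L \<Longrightarrow> b v \<noteq> 0 \<and> f (\<phi> (r `` {L})) = a v / b v"
          using f unfolding regQ unfolding proj_subspace_def space_with_functions.simps mem_Collect_eq
          by (elim ballE[of _ _ "\<sigma> x"]) auto
        show "\<exists>W. openin (subtopology affine_zariski U) W \<and> x \<in> W \<and> W \<subseteq> V \<and>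
           (\<exists>a\<in>affine_polys. \<exists>b\<in>affine_polys. \<forall>x\<in>W. b x \<noteq> 0 \<and> f x = a x / b x)"
        proof (intro exI[of _ "{x \<in> U. \<sigma> x \<in> W}"] conjI)
          show "openin (subtopology affine_zariski U) {x \<in> U. \<sigma> x \<in> W}"
            using opens W(1) unfolding tU tS by blast
          show "x \<in> {x \<in> U. \<sigma> x \<in> W}" using xU W(2) by blast
          show "{x \<in> U. \<sigma> x \<in> W} \<subseteq> V" using \<sigma> W(3) by auto
          \<comment> \<open>Evaluated at the representative \<open>s x\<close> of \<sigma> x, the
            local fraction becomes one of polynomials in \<open>x\<close>.\<close>
          have "b (s x) \<noteq> 0 \<and> f x = a (s x) / b (s x)" if "x \<in> {x \<in> U. \<sigma> x \<in> W}" for x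
            using eq[of "\<sigma> x", OF _ rep] \<sigma>[of x] \<phi>'[of "\<sigma> x"] that by auto
          then have "\<forall>x\<in>{x \<in> U. \<sigma> x \<in> W}. b (s x) \<noteq> 0 \<and> f x = a (s x) / b (s x)" by blast
          then have "\<exists>b\<in>affine_polys. \<forall>x\<in>{x \<in> U. \<sigma> x \<in> W}. b x \<noteq> 0 \<and> f x = a (s x) / b x"
            by (rule rev_bexI[OF pull_s[OF ab(2)]])
          then show "\<exists>a\<in>affine_polys. \<exists>b\<in>affine_polys.
              \<forall>x\<in>{x \<in> U. \<sigma> x \<in> W}. b x \<noteq> 0 \<and> f x = a x / b x"
            by (rule rev_bexI[OF pull_s[OF ab(1)]])
        qed
      qed
    qed
  qed
  ultimately have "isomorphism Q (affine_subspace U) \<phi>" unfolding isomorphism_def by blast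
  then show ?thesis unfolding isomorphic_def Q by blast
qed

text \<open>Density is checked on the line joining a point of a nonempty open set to \<open>x\<close>.\<close>

lemma affine_zariski_dense:
  fixes U :: "(complex ^ 'n) set"
  assumes g: "g \<in> affine_polys" and U: "{x. g x \<noteq> 0} \<subseteq> U" and x: "g x \<noteq> 0"
  shows "affine_zariski closure_of U = UNIV"
proof -
  have line: "\<exists>q. \<forall>t. f (y + t *s (z - y)) = poly q t" if "f \<in> affine_polys"
    for f :: "complex ^ 'n \<Rightarrow> complex" and y z
    using that unfolding affine_polys_def
  proof induction
    case (const c)
    then show ?case by (intro exI[of _ "[:c:]"]) simp
  next
    case (coord f)
    then obtain i where "f = (\<lambda>x. x $ i)" by blast
    then show ?case by (intro exI[of _ "[:y $ i, z $ i - y $ i:]"]) (simp add: algebra_simps)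
  next
    case (add f h)
    then obtain p q where "\<forall>t. f (y + t *s (z - y)) = poly p t" "\<forall>t. h (y + t *s (z - y)) = poly q t"
      by blast
    then show ?case by (intro exI[of _ "p + q"]) simp
  next
    case (mult f h)
    then obtain p q where "\<forall>t. f (y + t *s (z - y)) = poly p t" "\<forall>t. h (y + t *s (z - y)) = poly q t"
      by blast
    then show ?case by (intro exI[of _ "p * q"]) simp
  qed
  have "\<exists>z\<in>U. z \<in> T" if T: "openin affine_zariski T" "y \<in> T" for y T
  proof -
    obtain f where f: "f \<in> affine_polys" "f y \<noteq> 0" "{x. f x \<noteq> 0} \<subseteq> T"
      using T unfolding openin_affine_zariski by blast
    obtain q where q: "\<And>t. f (y + t *s (x - y)) = poly q t" using line[OF f(1)] by blast
    obtain p where p: "\<And>t. g (y + t *s (x - y)) = poly p t" using line[OF g] by blast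
    \<comment> \<open>At t = 0 the line passes through \<open>y\<close>, where \<open>f\<close> is
      nonzero, and at t = 1 through \<open>x\<close>, where \<open>g\<close> is nonzero. So both
      restrictions have finitely many roots.\<close>
    have "q \<noteq> 0" using q[of 0] f(2) by auto
    moreover have "p \<noteq> 0" using p[of 1] x by auto
    ultimately have "finite {t. poly (q * p) t = 0}" by (intro poly_roots_finite) simp
    then obtain t where "poly (q * p) t \<noteq> 0"
      using infinite_UNIV_char_0[where 'a = complex] by (metis (mono_tags) UNIV_I finite_subset mem_Collect_eq subsetI)
    then have "f (y + t *s (x - y)) \<noteq> 0" "g (y + t *s (x - y)) \<noteq> 0" using q p by auto
    then show ?thesis using U f(3) by blast
  qed
  then show ?thesis unfolding closure_of_def by (auto simp: topspace_affine_zariski)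
qed

section \<open>Determinants of families of vectors\<close>

text \<open>The bracket of Grassmann-Pluecker algebra. The columns are listed by a function on the
  index type, to match the determinant in \<open>realizations\<close>.\<close>

definition bracket :: "('e \<Rightarrow> 'a::comm_ring_1 ^ 'n) \<Rightarrow> ('n::finite \<Rightarrow> 'e) \<Rightarrow> 'a" where
  "bracket v b = det (\<chi> i j. v (b j) $ i)"

lemma bracket_cong: "(\<And>j. v (b j) = w (b j)) \<Longrightarrow> bracket v b = bracket w b"
  by (simp add: bracket_def)

lemma bracket_scale: "bracket (\<lambda>e. c e *s v e) b = (\<Prod>j\<in>UNIV. c (b j)) * bracket v b"
proof -
  have "bracket (\<lambda>e. c e *s v e) b = det (transpose (\<chi> i j. c (b j) * v (b j) $ i))"
    by (simp add: bracket_def det_transpose)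
  also have "transpose (\<chi> i j. c (b j) * v (b j) $ i) = (\<chi> j. c (b j) *s v (b j))"
    by (simp add: transpose_def vec_eq_iff)
  also have "det \<dots> = (\<Prod>j\<in>UNIV. c (b j)) * det (\<chi> j. v (b j))"
    by (rule det_rows_mul)
  also have "det (\<chi> j. v (b j)) = det (transpose (\<chi> i j. v (b j) $ i))"
    by (rule arg_cong[of _ _ det]) (simp add: transpose_def vec_eq_iff)
  finally show ?thesis by (simp add: bracket_def det_transpose)
qed

lemma bracket_matrix: "bracket (\<lambda>e. A *v v e) b = det A * bracket v b"
proof -
  have "(\<chi> i j. (A *v v (b j)) $ i) = A ** (\<chi> i j. v (b j) $ i)"
    by (simp add: vec_eq_iff matrix_vector_mult_def matrix_matrix_mult_def)
  then show ?thesis by (simp add: bracket_def det_mul)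
qed

text \<open>Two listings of one set differ by a permutation, which changes the determinant only by a
  sign. Dependence can thus be checked on sorted quadruples.\<close>

lemma bracket_zero_iff_range:
  fixes v :: "'e \<Rightarrow> 'a::idom ^ 'n"
  assumes "bij_betw b UNIV l" "bij_betw b' UNIV l"
  shows "bracket v b = 0 \<longleftrightarrow> bracket v b' = 0"
proof -
  define p where "p = inv_into UNIV b \<circ> b'"
  have p: "p permutes UNIV"
    unfolding p_def
    by (rule bij_imp_permutes[OF bij_betw_trans[OF assms(2) bij_betw_inv_into[OF assms(1)]]]) simp
  have "b (p j) = b' j" for j
    using assms by (auto simp: p_def bij_betw_def intro!: f_inv_into_f)
  then have "bracket v b' = of_int (sign p) * bracket v b"
    using det_permute_columns[OF p, of "\<chi> i j. v (b j) $ i"] by (simp add: bracket_def)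
  then show ?thesis by (simp add: sign_def)
qed

text \<open>Each term of the Leibniz formula contains exactly one coordinate of every listed vector,
  hence the 0-1 degree; injectivity of \<open>b\<close> keeps a label from counting twice.\<close>

lemma bracket_multihomogeneous:
  fixes b :: "'n::finite \<Rightarrow> 'e"
  assumes "finite E" "inj b" "range b \<subseteq> E"
  shows "(\<lambda>v. bracket v b) \<in> multihomogeneous E (\<lambda>e. if e \<in> range b then 1 else 0)"
proof -
  let ?G = "{\<lambda>v :: 'e \<Rightarrow> complex ^ 'n. v e $ i | e i. e \<in> E}"
  have "(\<lambda>v. \<Sum>p\<in>{p. p permutes (UNIV :: 'n set)}. of_int (sign p) * (\<Prod>i\<in>UNIV. v (b (p i)) $ i))
      \<in> polynomial_functions ?G"
    using assms(3)
    by (intro polynomial_functions_sum polynomial_functions.mult polynomial_functions.const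
          polynomial_functions_prod polynomial_functions.coord) blast
  moreover have "(\<Prod>e\<in>E. c e ^ (if e \<in> range b then 1 else 0)) = (\<Prod>j\<in>UNIV. c (b j))"
    for c :: "'e \<Rightarrow> complex"
  proof -
    have "(\<Prod>e\<in>E. c e ^ (if e \<in> range b then 1 else 0)) = (\<Prod>e\<in>E. if e \<in> range b then c e else 1)"
      by (intro prod.cong) auto
    also have "\<dots> = (\<Prod>e\<in>range b. c e)"
      using assms by (simp add: prod.inter_restrict[symmetric] Int_absorb1)
    also have "\<dots> = (\<Prod>j\<in>UNIV. c (b j))" using assms(2) by (simp add: prod.reindex)
    finally show ?thesis .
  qed
  ultimately show ?thesis
    by (simp add: multihomogeneous_def bracket_scale del: power_0 prod.If_cases)
       (simp add: bracket_def det_def)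
qed

lemma det_4:
  "det (A :: 'a::comm_ring_1 ^ 4 ^ 4) =
     A$1$1 * (A$2$2 * (A$3$3 * A$4$4 - A$3$4 * A$4$3) - A$2$3 * (A$3$2 * A$4$4 - A$3$4 * A$4$2)
       + A$2$4 * (A$3$2 * A$4$3 - A$3$3 * A$4$2))
   - A$1$2 * (A$2$1 * (A$3$3 * A$4$4 - A$3$4 * A$4$3) - A$2$3 * (A$3$1 * A$4$4 - A$3$4 * A$4$1)
       + A$2$4 * (A$3$1 * A$4$3 - A$3$3 * A$4$1))
   + A$1$3 * (A$2$1 * (A$3$2 * A$4$4 - A$3$4 * A$4$2) - A$2$2 * (A$3$1 * A$4$4 - A$3$4 * A$4$1)
       + A$2$4 * (A$3$1 * A$4$2 - A$3$2 * A$4$1))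
   - A$1$4 * (A$2$1 * (A$3$2 * A$4$3 - A$3$3 * A$4$2) - A$2$2 * (A$3$1 * A$4$3 - A$3$3 * A$4$1)
       + A$2$3 * (A$3$1 * A$4$2 - A$3$2 * A$4$1))"
proof -
  have f: "finite {2::4, 3, 4}" "1 \<notin> {2::4, 3, 4}" "finite {3::4, 4}" "2 \<notin> {3::4, 4}"
    "finite {4::4}" "3 \<notin> {4::4}"
    by auto
  show ?thesis
    unfolding det_def UNIV_4
    unfolding sum_over_permutations_insert[OF f(1,2)]
    unfolding sum_over_permutations_insert[OF f(3,4)]
    unfolding sum_over_permutations_insert[OF f(5,6)]
    unfolding permutes_sing
    by (simp add: sign_swap_id permutation_swap_id permutation_compose sign_compose sign_id swap_id_eq
        algebra_simps)
qed

section \<open>The matroid of the arrangement\<close>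

lemma vector_4 [simp]:
  "(vector [a, b, c, d] :: 'a::zero ^ 4) $ 1 = a"
  "(vector [a, b, c, d] :: 'a ^ 4) $ 2 = b"
  "(vector [a, b, c, d] :: 'a ^ 4) $ 3 = c"
  "(vector [a, b, c, d] :: 'a ^ 4) $ 4 = d"
  unfolding vector_def by simp_all

lemma exhaust_5: "x = 1 \<or> x = 2 \<or> x = 3 \<or> x = 4 \<or> x = (5 :: 5)"
proof (induct x)
  case (of_int z)
  then have "z = 0 \<or> z = 1 \<or> z = 2 \<or> z = 3 \<or> z = 4" by fastforce
  then show ?case by auto
qed

text \<open>The dual points, in the order of \<open>factors\<close> and with coordinates in the
  order x, y, z, w. Planes 3 to 11 share the point x = y = z = 0, so their normals lie in the dual
  plane where the last coordinate is 0.\<close>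

definition normal :: "nat \<Rightarrow> complex ^ 4" where
  "normal e =
     [vector [1, -3, 5, 1], vector [0, 0, 0, 1], vector [1, 0, 0, 0], vector [0, 1, 0, 0],
      vector [1, -1, -1, 0], vector [1, -1, 1, 0], vector [2, 1, -2, 0], vector [1, 3, -3, 0],
      vector [3, 2, 3, 0], vector [1, 5, 5, 0], vector [7, -4, -1, 0]] ! (e - 1)"

text \<open>The plane \<open>w = 0\<close> contains the points 3 to 11 and meets the line through 1 and 2 in a point
  \<open>p\<close>.  The collinear triples among these ten points are
  \<open>3 5 10\<close>, \<open>3 6 8\<close>, \<open>4 5 7\<close>, \<open>4 6 9\<close>, \<open>4 10 p\<close>, \<open>7 8 11\<close>, \<open>9 10 11\<close>.  With the frame 3, 4, 5, 6 made
  standard, the points 10, 8, 7, 9 and then \<open>p\<close> have one free coordinate each, and 11 is the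
  intersection of the lines \<open>7 8\<close> and \<open>9 10\<close>, a cross product of cross products.\<close>

definition normal_form :: "complex ^ 5 \<Rightarrow> nat \<Rightarrow> complex ^ 4" where
  "normal_form x e =
     [vector [x $ 1, x $ 5, 1, 1], vector [0, 0, 0, 1], vector [1, 0, 0, 0], vector [0, 1, 0, 0],
      vector [0, 0, 1, 0], vector [1, 1, 1, 0], vector [0, x $ 3, 1, 0], vector [x $ 2, 1, 1, 0],
      vector [1, x $ 4, 1, 0], vector [x $ 1, 0, 1, 0],
      vector [x $ 2 * x $ 3 * (x $ 1 - 1) - x $ 1 * x $ 2 * x $ 4,
              x $ 4 * (x $ 1 * (x $ 3 - 1) - x $ 2 * x $ 3),
              (x $ 3 - 1) * (x $ 1 - 1) - x $ 2 * x $ 4, 0]] ! (e - 1)"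

lemma normal_simps:
  "normal (Suc 0) = vector [1, -3, 5, 1]" "normal 2 = vector [0, 0, 0, 1]"
  "normal 3 = vector [1, 0, 0, 0]" "normal 4 = vector [0, 1, 0, 0]"
  "normal 5 = vector [1, -1, -1, 0]" "normal 6 = vector [1, -1, 1, 0]"
  "normal 7 = vector [2, 1, -2, 0]" "normal 8 = vector [1, 3, -3, 0]"
  "normal 9 = vector [3, 2, 3, 0]" "normal 10 = vector [1, 5, 5, 0]"
  "normal 11 = vector [7, -4, -1, 0]"
  by (simp_all add: normal_def)

lemma normal_form_simps:
  "normal_form x (Suc 0) = vector [x $ 1, x $ 5, 1, 1]" "normal_form x 2 = vector [0, 0, 0, 1]"
  "normal_form x 3 = vector [1, 0, 0, 0]" "normal_form x 4 = vector [0, 1, 0, 0]"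
  "normal_form x 5 = vector [0, 0, 1, 0]" "normal_form x 6 = vector [1, 1, 1, 0]"
  "normal_form x 7 = vector [0, x $ 3, 1, 0]" "normal_form x 8 = vector [x $ 2, 1, 1, 0]"
  "normal_form x 9 = vector [1, x $ 4, 1, 0]" "normal_form x 10 = vector [x $ 1, 0, 1, 0]"
  "normal_form x 11 =
     vector [x $ 2 * x $ 3 * (x $ 1 - 1) - x $ 1 * x $ 2 * x $ 4,
             x $ 4 * (x $ 1 * (x $ 3 - 1) - x $ 2 * x $ 3),
             (x $ 3 - 1) * (x $ 1 - 1) - x $ 2 * x $ 4, 0]"
  by (simp_all add: normal_form_def)

section \<open>Four labelled points, and collinearity in the dual plane\<close>

definition quad :: "'e \<Rightarrow> 'e \<Rightarrow> 'e \<Rightarrow> 'e \<Rightarrow> 4 \<Rightarrow> 'e" where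
  "quad a b c d j = (if j = 1 then a else if j = 2 then b else if j = 3 then c else d)"

lemma quad_simps [simp]:
  "quad a b c d 1 = a" "quad a b c d 2 = b" "quad a b c d 3 = c" "quad a b c d 4 = d"
  by (simp_all add: quad_def)

lemma range_quad [simp]: "range (quad a b c d) = {a, b, c, d}"
  by (auto simp: UNIV_4)

lemma inj_quad_iff [simp]: "inj (quad a b c d) \<longleftrightarrow> distinct [a, b, c, d]"
  by (auto simp: inj_def forall_4)

text \<open>The determinant of the first three coordinates. It tests collinearity after projection
  from the point 2, that is (0, 0, 0, 1), and this projection sends 1 to \<open>p\<close>.\<close>

definition triple_det :: "('e \<Rightarrow> complex ^ 4) \<Rightarrow> 'e \<Rightarrow> 'e \<Rightarrow> 'e \<Rightarrow> complex" where
  "triple_det v a b c =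
     v a $ 1 * (v b $ 2 * v c $ 3 - v b $ 3 * v c $ 2)
   - v b $ 1 * (v a $ 2 * v c $ 3 - v a $ 3 * v c $ 2)
   + v c $ 1 * (v a $ 2 * v b $ 3 - v a $ 3 * v b $ 2)"

abbreviation E11 :: "nat set" where "E11 \<equiv> {1..11}"

lemma mem_E11: "e \<in> E11 \<longleftrightarrow> e \<in> set [1, 2, 3, 4, 5, 6, 7, 8, 9, 10, 11]"
  by (simp add: atLeastAtMost_iff) presburger

text \<open>Index 1 stands for the point \<open>p\<close>, which has the same first three coordinates.  The
  conditionals keep the simplifier from evaluating the determinants of unordered triples.\<close>

lemma collinear_triples:
  assumes "a \<in> set [1, 3, 4, 5, 6, 7, 8, 9, 10, 11]" "b \<in> set [3, 4, 5, 6, 7, 8, 9, 10, 11]"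
    "c \<in> set [3, 4, 5, 6, 7, 8, 9, 10, 11]" "a < b" "b < c" "triple_det normal a b c = 0"
  shows "(a, b, c) \<in> {(3, 5, 10), (3, 6, 8), (4, 5, 7), (4, 6, 9), (1, 4, 10), (7, 8, 11), (9, 10, 11)}"
proof -
  let ?D = "{(3, 5, 10), (3, 6, 8), (4, 5, 7), (4, 6, 9), (1, 4, 10), (7, 8, 11), (9, 10, 11)}
    :: (nat \<times> nat \<times> nat) set"
  have "\<forall>a\<in>set [1, 3, 4, 5, 6, 7, 8, 9, 10, 11]. \<forall>b\<in>set [3, 4, 5, 6, 7, 8, 9, 10, 11].
    if a < b then \<forall>c\<in>set [3, 4, 5, 6, 7, 8, 9, 10, 11].
      if b < c then triple_det normal a b c = 0 \<longrightarrow> (a, b, c) \<in> ?D else True else True"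
    by (simp add: triple_det_def normal_simps)
  then have "if a < b then \<forall>c\<in>set [3, 4, 5, 6, 7, 8, 9, 10, 11].
      if b < c then triple_det normal a b c = 0 \<longrightarrow> (a, b, c) \<in> ?D else True else True"
    using assms(1,2) by blast
  then have "if b < c then triple_det normal a b c = 0 \<longrightarrow> (a, b, c) \<in> ?D else True"
    unfolding if_P[OF assms(4)] using assms(3) by blast
  then show ?thesis using assms(5,6) by simp
qed

text \<open>Five of the seven collinearities are visible in the shape of the coordinates; the two
  through 11 are the identities that its cross product was built to satisfy.\<close>

lemma triple_det_normal_form:
  assumes "a \<in> set [1, 3, 4, 5, 6, 7, 8, 9, 10, 11]" "b \<in> set [3, 4, 5, 6, 7, 8, 9, 10, 11]"
    "c \<in> set [3, 4, 5, 6, 7, 8, 9, 10, 11]" "a < b" "b < c" "triple_det normal a b c = 0"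
  shows "triple_det (normal_form x) a b c = 0"
  using collinear_triples[OF assms]
  by (elim insertE emptyE) (simp_all add: triple_det_def normal_form_simps, simp_all add: algebra_simps)

lemma bracket_quad_plane:
  assumes "v a $ 4 = 0" "v b $ 4 = 0" "v c $ 4 = 0" "v d $ 4 = 0"
  shows "bracket v (quad a b c d) = 0"
  using assms by (simp add: bracket_def det_4)

text \<open>A tetrahedron over a triangle in the plane degenerates exactly when its apex lies in the
  plane or the triangle is flat.\<close>

lemma bracket_quad_apex:
  assumes "v b $ 4 = 0" "v c $ 4 = 0" "v d $ 4 = 0"
  shows "bracket v (quad a b c d) = - v a $ 4 * triple_det v b c d"
  using assms by (simp add: bracket_def det_4 triple_det_def algebra_simps)

text \<open>Expansion along the column of the point 2 forgets the last coordinate of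
  \<open>a\<close>, so dependence becomes collinearity of the projected \<open>a\<close> with
  \<open>c\<close> and \<open>d\<close>.\<close>

lemma bracket_quad_edge:
  assumes "v c $ 4 = 0" "v d $ 4 = 0" "v b = vector [0, 0, 0, 1]"
  shows "bracket v (quad a b c d) = triple_det v a c d"
  using assms by (simp add: bracket_def det_4 triple_det_def algebra_simps)

lemma plane_members:
  assumes "e \<in> {3..11}"
  shows "normal e $ 4 = 0" "normal_form x e $ 4 = 0"
proof -
  have "e \<in> set [3, 4, 5, 6, 7, 8, 9, 10, 11]" using assms by simp presburger
  then show "normal e $ 4 = 0" "normal_form x e $ 4 = 0"
    by (auto simp: normal_simps normal_form_simps)
qed

lemma bracket_normal_form_sorted:
  assumes abcd: "a < b" "b < c" "c < d" "a \<in> E11" "d \<in> E11"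
    and z: "bracket normal (quad a b c d) = 0"
  shows "bracket (normal_form x) (quad a b c d) = 0"
proof -
  have s: "e \<in> set [3, 4, 5, 6, 7, 8, 9, 10, 11]" if "e \<in> {3..11}" for e :: nat
    using that by simp presburger
  have p: "normal e $ 4 = 0" "normal_form x e $ 4 = 0" if "e \<in> {3..11}" for e
    using plane_members[OF that] .
  \<comment> \<open>The cases are none, both, or exactly one of the points 1 and 2 off the plane; in
    a sorted quadruple they come first.\<close>
  consider "a \<ge> 3" | "a = 1" "b = 2" | "a = 1 \<or> a = 2" "b \<ge> 3"
    using abcd by force
  then show ?thesis
  proof cases
    case 1
    then show ?thesis using abcd p by (intro bracket_quad_plane) auto
  next
    case 2
    have m: "c \<in> {3..11}" "d \<in> {3..11}" using abcd 2 by auto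
    have "triple_det normal a c d = 0"
      using z bracket_quad_edge[of normal c d b a] p m 2 by (simp add: normal_simps)
    then have "triple_det (normal_form x) a c d = 0"
      using abcd 2 s m by (intro triple_det_normal_form) auto
    then show ?thesis
      using bracket_quad_edge[of "normal_form x" c d b a] p m 2 by (simp add: normal_form_simps)
  next
    case 3
    have m: "b \<in> {3..11}" "c \<in> {3..11}" "d \<in> {3..11}" using abcd 3 by auto
    have "normal a $ 4 \<noteq> 0" using 3 by (auto simp: normal_simps)
    then have "triple_det normal b c d = 0"
      using z bracket_quad_apex[of normal b c d a] p m by simp
    then have "triple_det (normal_form x) b c d = 0"
      using abcd 3 s m by (intro triple_det_normal_form) auto
    then show ?thesis using bracket_quad_apex[of "normal_form x" b c d a] p m by simp
  qed
qed

text \<open>The non-bases are respected for every parameter value. Hence only the bases impose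
  conditions on \<open>x\<close>, and these are open.\<close>

lemma bracket_normal_form_zero:
  assumes b: "inj b" "range b \<subseteq> E11" and z: "bracket normal b = 0"
  shows "bracket (normal_form x) b = 0"
proof -
  let ?l = "sorted_list_of_set (range b)"
  have "length ?l = Suc (Suc (Suc (Suc 0)))" using b(1) by (simp add: card_image)
  then obtain p q r t where l: "?l = [p, q, r, t]"
    by (auto simp only: length_Suc_conv length_0_conv)
  have "sorted_wrt (<) ?l" by simp
  then have lt: "p < q" "q < r" "r < t" by (auto simp: l)
  have set: "range b = {p, q, r, t}" using set_sorted_list_of_set[of "range b"] l by auto
  have bij: "bij_betw b UNIV (range b)" "bij_betw (quad p q r t) UNIV (range b)"
    using b(1) lt by (auto simp: bij_betw_def set simp del: set_sorted_list_of_set)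
  have "bracket normal (quad p q r t) = 0"
    using z bracket_zero_iff_range[OF bij] by blast
  then have "bracket (normal_form x) (quad p q r t) = 0"
    using lt b(2) by (intro bracket_normal_form_sorted) (auto simp: set)
  then show ?thesis using bracket_zero_iff_range[OF bij] by blast
qed

text \<open>A common point of the four planes is a nonzero kernel vector of the matrix whose rows
  are their normals; the bracket is the determinant of its transpose.\<close>

lemma arrangement_bases_iff:
  assumes "inj b" "range b \<subseteq> E11"
  shows "range b \<in> arrangement_bases E11 \<A> \<longleftrightarrow> bracket normal b \<noteq> 0"
proof -
  let ?M = "\<chi> j k. normal (b j) $ k"
  have factor: "(factors ! (i - 1)) (p $ 1) (p $ 2) (p $ 3) (p $ 4) = (\<Sum>k\<in>UNIV. normal i $ k * p $ k)"
    if "i \<in> E11" for i and p :: "complex ^ 4"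
    using that unfolding mem_E11 by (auto simp: factors_def normal_simps sum_4)
  have span: "vec.span {p} \<in> \<A> i \<longleftrightarrow> (\<Sum>k\<in>UNIV. normal i $ k * p $ k) = 0"
    if "i \<in> E11" "p \<noteq> 0" for i p
  proof -
    have "(\<forall>q\<in>vec.span {p}. (\<Sum>k\<in>UNIV. normal i $ k * q $ k) = 0) \<longleftrightarrow>
        (\<Sum>k\<in>UNIV. normal i $ k * p $ k) = 0"
    proof
      assume "(\<Sum>k\<in>UNIV. normal i $ k * p $ k) = 0"
      then have "(\<Sum>k\<in>UNIV. normal i $ k * (c *s p) $ k) = 0" for c
        by (simp add: mult.left_commute sum_distrib_left[symmetric])
      then show "\<forall>q\<in>vec.span {p}. (\<Sum>k\<in>UNIV. normal i $ k * q $ k) = 0"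
        by (auto simp: vec.span_singleton)
    qed (auto intro: vec.span_base)
    then show ?thesis
      using that unfolding \<A>_def hyperplane_def factor[OF that(1)] proj_space_def by blast
  qed
  have "(\<Inter>i\<in>range b. \<A> i) = {} \<longleftrightarrow> (\<forall>p. ?M *v p = 0 \<longrightarrow> p = 0)"
  proof -
    have "?M *v p = 0 \<longleftrightarrow> (\<forall>i\<in>range b. vec.span {p} \<in> \<A> i)" if "p \<noteq> 0" for p
    proof -
      have "?M *v p = 0 \<longleftrightarrow> (\<forall>j. (\<Sum>k\<in>UNIV. normal (b j) $ k * p $ k) = 0)"
        by (simp add: matrix_vector_mult_def vec_eq_iff)
      also have "\<dots> \<longleftrightarrow> (\<forall>j. vec.span {p} \<in> \<A> (b j))"
        using span[OF _ that] assms(2) by (meson rangeI subsetD)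
      finally show ?thesis by blast
    qed
    note ker = this
    have pt: "\<exists>p. p \<noteq> 0 \<and> P = vec.span {p}" if "P \<in> (\<Inter>i\<in>range b. \<A> i)" for P
      using that unfolding \<A>_def hyperplane_def proj_space_def by blast
    show ?thesis
    proof (intro iffI allI impI)
      fix p assume "(\<Inter>i\<in>range b. \<A> i) = {}" "?M *v p = 0"
      then show "p = 0" using ker[of p] by (metis INT_I empty_iff)
    next
      assume "\<forall>p. ?M *v p = 0 \<longrightarrow> p = 0"
      then have "P \<notin> (\<Inter>i\<in>range b. \<A> i)" for P using ker pt by (metis INT_D)
      then show "(\<Inter>i\<in>range b. \<A> i) = {}" by blast
    qed
  qed
  also have "\<dots> \<longleftrightarrow> det ?M \<noteq> 0"
    using matrix_left_invertible_ker[of ?M] by (metis invertible_det_nz invertible_left_inverse)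
  also have "det ?M = bracket normal b"
    using det_transpose[of ?M] by (simp add: bracket_def transpose_def)
  finally show ?thesis using assms by (simp add: arrangement_bases_def card_image)
qed

section \<open>Normal forms of realizations\<close>

text \<open>The matroid condition on vectors instead of lines, with \<open>normal\<close> as the
  model realization, so that bases are compared bracket by bracket.\<close>

definition realizes :: "(nat \<Rightarrow> complex ^ 4) \<Rightarrow> bool" where
  "realizes v \<longleftrightarrow>
     (\<forall>b. inj b \<longrightarrow> range b \<subseteq> E11 \<longrightarrow> (bracket v b = 0 \<longleftrightarrow> bracket normal b = 0))"

lemma realizes_quad:
  assumes "realizes v" "distinct [a, b, c, d]" "{a, b, c, d} \<subseteq> E11"
  shows "bracket v (quad a b c d) = 0 \<longleftrightarrow> bracket normal (quad a b c d) = 0"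
  using assms by (simp add: realizes_def del: atLeastAtMost_iff)

lemma realizes_cong:
  assumes "\<And>e. e \<in> E11 \<Longrightarrow> v e = w e" shows "realizes v \<longleftrightarrow> realizes w"
proof -
  have "bracket v b = bracket w b" if "range b \<subseteq> E11" for b :: "4 \<Rightarrow> nat"
    using that by (intro bracket_cong assms) blast
  then show ?thesis by (auto simp: realizes_def)
qed

lemma realizes_matrix:
  assumes "invertible A" shows "realizes (\<lambda>e. A *v v e) \<longleftrightarrow> realizes v"
  using assms by (simp add: realizes_def bracket_matrix invertible_det_nz)

lemma realizes_scale:
  assumes "\<And>e. e \<in> E11 \<Longrightarrow> c e \<noteq> 0" shows "realizes (\<lambda>e. c e *s v e) \<longleftrightarrow> realizes v"
proof -
  have "(\<Prod>j\<in>UNIV. c (b j)) \<noteq> 0" if "range b \<subseteq> E11" for b :: "4 \<Rightarrow> nat"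
  proof -
    have "c (b j) \<noteq> 0" for j using that by (intro assms) blast
    then show ?thesis by simp
  qed
  then show ?thesis by (auto simp: realizes_def bracket_scale)
qed

lemma frame_matrix:
  fixes v :: "'e \<Rightarrow> complex ^ 4"
  assumes "bracket v (quad a b c d) \<noteq> 0"
  obtains A :: "complex ^ 4 ^ 4" where "invertible A"
    "A *v v a = vector [1, 0, 0, 0]" "A *v v b = vector [0, 1, 0, 0]"
    "A *v v c = vector [0, 0, 1, 0]" "A *v v d = vector [0, 0, 0, 1]"
proof -
  let ?M = "\<chi> i j. v (quad a b c d j) $ i"
  have "invertible ?M" using assms by (simp add: bracket_def invertible_det_nz)
  then obtain A where A: "A ** ?M = mat 1" "?M ** A = mat 1" by (auto simp: invertible_def)
  then have "invertible A" by (auto simp: invertible_def)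
  moreover have "(A *v v (quad a b c d j)) $ i = (if i = j then 1 else 0)" for i j
  proof -
    have "(A *v v (quad a b c d j)) $ i = (A ** ?M) $ i $ j"
      by (simp add: matrix_vector_mult_def matrix_matrix_mult_def)
    then show ?thesis by (simp add: A mat_def)
  qed
  from this[of 1] this[of 2] this[of 3] this[of 4]
  have "A *v v a = vector [1, 0, 0, 0]" "A *v v b = vector [0, 1, 0, 0]"
    "A *v v c = vector [0, 0, 1, 0]" "A *v v d = vector [0, 0, 0, 1]"
    by (simp_all add: vec_eq_iff forall_4)
  ultimately show ?thesis by (rule that)
qed

lemma diagonal_matrix_vector:
  fixes d u :: "complex ^ 'n"
  shows
  "(\<chi> i j. if i = j then d $ i else 0) *v u = (\<chi> i. d $ i * u $ i)"
  by (simp add: matrix_vector_mult_def vec_eq_iff if_distrib[of "\<lambda>x. x * _"] cong: if_cong)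

lemma invertible_diagonal_matrix:
  fixes d :: "complex ^ 'n"
  assumes "\<And>i. d $ i \<noteq> 0"
  shows "invertible (\<chi> i j. if i = j then d $ i else 0)"
proof -
  have "det (\<chi> i j. if i = j then d $ i else 0) = (\<Prod>i\<in>UNIV. d $ i)"
    by (subst det_diagonal) auto
  then show ?thesis using assms by (simp add: invertible_det_nz)
qed

lemma normal_form_exists:
  assumes v: "realizes v"
  obtains A c x where "invertible A" "\<And>e. e \<in> E11 \<Longrightarrow> c e \<noteq> 0"
    "\<And>e. e \<in> E11 \<Longrightarrow> A *v v e = c e *s normal_form x e"
proof -
  note bracket_simps = bracket_def det_4 normal_simps
  have "bracket v (quad 3 4 5 2) \<noteq> 0"
    using realizes_quad[OF v, of 3 4 5 2] by (simp add: bracket_simps)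
  then obtain A :: "complex ^ 4 ^ 4" where A: "invertible A" and
    "A *v v 3 = vector [1, 0, 0, 0]" "A *v v 4 = vector [0, 1, 0, 0]"
    "A *v v 5 = vector [0, 0, 1, 0]" "A *v v 2 = vector [0, 0, 0, 1]"
    by (rule frame_matrix)
  moreover define u where "u e = A *v v e" for e
  ultimately have u: "u 3 = vector [1, 0, 0, 0]" "u 4 = vector [0, 1, 0, 0]"
    "u 5 = vector [0, 0, 1, 0]" "u 2 = vector [0, 0, 0, 1]"
    by simp_all
  have "realizes u" using v realizes_matrix[OF A] by (simp add: u_def[abs_def])
  note ru = realizes_quad[OF this]
  have u6: "u 6 $ 1 \<noteq> 0" "u 6 $ 2 \<noteq> 0" "u 6 $ 3 \<noteq> 0"
    using ru[of 6 4 5 2] ru[of 3 6 5 2] ru[of 3 4 6 2] by (simp_all add: u bracket_simps)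
  have u1: "u 1 $ 3 \<noteq> 0" "u 1 $ 4 \<noteq> 0"
    using ru[of 3 4 1 2] ru[of 3 4 5 1] by (simp_all add: u bracket_simps)
  \<comment> \<open>Diagonal matrices keep the four coordinate points. The first three entries move
    6 to the unit point of the plane; the fourth makes the last two coordinates of 1 equal.\<close>
  define d :: "complex ^ 4" where
    "d = vector [1 / u 6 $ 1, 1 / u 6 $ 2, 1 / u 6 $ 3, u 1 $ 3 / (u 6 $ 3 * u 1 $ 4)]"
  define D where "D = (\<chi> i j. if i = j then d $ i else 0)"
  have d: "d $ i \<noteq> 0" for i
    using exhaust_4[of i] u6 u1 by (auto simp: d_def)
  have D: "invertible D" unfolding D_def using d by (rule invertible_diagonal_matrix)
  define w where "w e = D *v u e" for e
  have w_nth: "w e $ i = d $ i * u e $ i" for e i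
    by (simp add: w_def D_def diagonal_matrix_vector)
  have w: "w 3 = vector [d $ 1, 0, 0, 0]" "w 4 = vector [0, d $ 2, 0, 0]"
    "w 5 = vector [0, 0, d $ 3, 0]" "w 2 = vector [0, 0, 0, d $ 4]"
    by (simp_all add: vec_eq_iff forall_4 w_nth u)
  have w6: "w 6 $ 1 = 1" "w 6 $ 2 = 1" "w 6 $ 3 = 1"
    using u6 by (simp_all add: w_nth d_def)
  have w1: "w 1 $ 4 = w 1 $ 3" using u1 by (simp add: w_nth d_def)
  have "realizes w"
    using \<open>realizes u\<close> realizes_matrix[OF D] by (simp add: w_def[abs_def])
  note rw = realizes_quad[OF this]
  have wE: "w e = c *s normal_form x e \<longleftrightarrow> (\<forall>i. w e $ i = c * normal_form x e $ i)" for e c x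
    by (simp add: vec_eq_iff)
  have plane: "w 6 $ 4 = 0" "w 7 $ 4 = 0" "w 8 $ 4 = 0" "w 9 $ 4 = 0" "w 10 $ 4 = 0" "w 11 $ 4 = 0"
    using rw[of 3 4 5 6] rw[of 3 4 5 7] rw[of 3 4 5 8] rw[of 3 4 5 9] rw[of 3 4 5 10] rw[of 3 4 5 11]
    by (simp_all add: w bracket_simps d)
  \<comment> \<open>These are the coordinates used for scaling. For 11 it is the second one, because
    that coordinate of its normal form factors into terms known to be nonzero.\<close>
  have scale: "w 1 $ 3 \<noteq> 0" "w 7 $ 3 \<noteq> 0" "w 8 $ 3 \<noteq> 0" "w 9 $ 3 \<noteq> 0" "w 10 $ 3 \<noteq> 0" "w 11 $ 2 \<noteq> 0"
    using rw[of 3 4 1 2] rw[of 3 4 7 2] rw[of 3 4 8 2] rw[of 3 4 9 2] rw[of 3 4 10 2] rw[of 3 11 5 2]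
    by (simp_all add: w bracket_simps d)
  have lines: "w 7 $ 1 = 0" "w 10 $ 2 = 0" "w 8 $ 2 = w 8 $ 3" "w 9 $ 1 = w 9 $ 3"
    using rw[of 7 4 5 2] rw[of 3 10 5 2] rw[of 3 6 8 2] rw[of 4 6 9 2]
    by (simp_all add: w w6 bracket_simps d)
  have line1: "w 1 $ 1 * w 10 $ 3 = w 1 $ 3 * w 10 $ 1"
    using rw[of 4 10 1 2] by (simp add: w bracket_simps d lines algebra_simps)
  define x :: "complex ^ 5" where
    "x = vector [w 10 $ 1 / w 10 $ 3, w 8 $ 1 / w 8 $ 3, w 7 $ 2 / w 7 $ 3, w 9 $ 2 / w 9 $ 3,
       w 1 $ 2 / w 1 $ 3]"
  have x: "x $ 1 = w 10 $ 1 / w 10 $ 3" "x $ 2 = w 8 $ 1 / w 8 $ 3" "x $ 3 = w 7 $ 2 / w 7 $ 3"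
    "x $ 4 = w 9 $ 2 / w 9 $ 3" "x $ 5 = w 1 $ 2 / w 1 $ 3"
    by (simp_all add: x_def vector_def)
  define c where
    "c e = [w 1 $ 3, d $ 4, d $ 1, d $ 2, d $ 3, 1, w 7 $ 3, w 8 $ 3, w 9 $ 3, w 10 $ 3,
      w 11 $ 2 / normal_form x 11 $ 2] ! (e - 1)" for e :: nat
  have c: "c (Suc 0) = w 1 $ 3" "c 2 = d $ 4" "c 3 = d $ 1" "c 4 = d $ 2" "c 5 = d $ 3" "c 6 = 1"
    "c 7 = w 7 $ 3" "c 8 = w 8 $ 3" "c 9 = w 9 $ 3" "c 10 = w 10 $ 3"
    "c 11 = w 11 $ 2 / normal_form x 11 $ 2"
    by (simp_all add: c_def)
  have easy: "w e = c e *s normal_form x e" if "e \<in> set [1, 2, 3, 4, 5, 6, 7, 8, 9, 10]" for e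
    using that scale line1
    by (auto simp: vec_eq_iff forall_4 normal_form_simps c x w w6 w1[simplified] plane lines field_simps)
  have w_eq: "w 7 $ 2 = x $ 3 * w 7 $ 3" "w 8 $ 1 = x $ 2 * w 8 $ 3" "w 9 $ 2 = x $ 4 * w 9 $ 3"
    "w 10 $ 1 = x $ 1 * w 10 $ 3"
    using scale by (simp_all add: x)
  \<comment> \<open>The coefficients of \<open>w 11\<close> form the cross product of the normalized
    points 7 and 8, the line joining them; likewise for 9 and 10 below.\<close>
  have "bracket w (quad 7 8 11 2) = d $ 4 * (w 7 $ 3 * w 8 $ 3 *
      ((x $ 3 - 1) * w 11 $ 1 + x $ 2 * w 11 $ 2 - x $ 2 * x $ 3 * w 11 $ 3))"
    by (simp add: bracket_def det_4 w plane lines w_eq algebra_simps)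
  moreover have "bracket w (quad 7 8 11 2) = 0"
    using rw[of 7 8 11 2] by (simp add: bracket_simps)
  ultimately have n: "(x $ 3 - 1) * w 11 $ 1 + x $ 2 * w 11 $ 2 - x $ 2 * x $ 3 * w 11 $ 3 = 0"
    using scale d by simp
  have "bracket w (quad 9 10 11 2) = d $ 4 * (w 9 $ 3 * w 10 $ 3 *
      (x $ 4 * w 11 $ 1 + (x $ 1 - 1) * w 11 $ 2 - x $ 4 * x $ 1 * w 11 $ 3))"
    by (simp add: bracket_def det_4 w plane lines w_eq algebra_simps)
  moreover have "bracket w (quad 9 10 11 2) = 0"
    using rw[of 9 10 11 2] by (simp add: bracket_simps)
  ultimately have m: "x $ 4 * w 11 $ 1 + (x $ 1 - 1) * w 11 $ 2 - x $ 4 * x $ 1 * w 11 $ 3 = 0"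
    using scale d by simp
  have "bracket w (quad 7 8 10 2) = d $ 4 * (w 7 $ 3 * w 8 $ 3 * w 10 $ 3 *
      (x $ 1 * (x $ 3 - 1) - x $ 2 * x $ 3))"
    by (simp add: bracket_def det_4 w plane lines w_eq algebra_simps)
  moreover have "bracket w (quad 7 8 10 2) \<noteq> 0"
    using rw[of 7 8 10 2] by (simp add: bracket_simps)
  ultimately have "x $ 1 * (x $ 3 - 1) - x $ 2 * x $ 3 \<noteq> 0" by auto
  moreover have "x $ 4 \<noteq> 0"
    using rw[of 3 9 10 2] by (simp add: bracket_simps w plane lines w_eq)
  ultimately have s2: "normal_form x 11 $ 2 \<noteq> 0" by (simp add: normal_form_simps)
  \<comment> \<open>Eliminating one coordinate from the two line equations \<open>n\<close> and
    \<open>m\<close> shows that 11 is proportional to the cross product of the lines.\<close>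
  have "w 11 $ 1 * normal_form x 11 $ 2 = w 11 $ 2 * normal_form x 11 $ 1"
    "w 11 $ 3 * normal_form x 11 $ 2 = w 11 $ 2 * normal_form x 11 $ 3"
    using n m by (simp_all add: normal_form_simps) algebra+
  then have "w 11 = c 11 *s normal_form x 11"
    using s2 plane by (simp add: vec_eq_iff forall_4 c field_simps) (simp add: normal_form_simps)
  then have "w e = c e *s normal_form x e" if "e \<in> E11" for e
    using that easy unfolding mem_E11 by auto
  moreover have "c e \<noteq> 0" if "e \<in> E11" for e
    using that scale d s2 unfolding mem_E11 by (auto simp: c)
  moreover have "invertible (D ** A)" using D A by (rule invertible_mult)
  moreover have "(D ** A) *v v e = w e" for e
    by (simp add: w_def u_def matrix_vector_mul_assoc)
  ultimately show ?thesis using that by metis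
qed

section \<open>The realization space\<close>

lemma span_scale_singleton:
  assumes "c \<noteq> 0" shows "vec.span {c *s x} = vec.span {x :: complex ^ 'n}"
proof -
  have "k *s x = (k / c) *s (c *s x)" for k using assms by simp
  moreover have "k *s (c *s x) = (k * c) *s x" for k by simp
  ultimately show ?thesis unfolding vec.span_singleton by (intro equalityI subsetI; blast)
qed

lemma image_span_singleton: "(*v) A ` vec.span {x} = vec.span {A *v x :: complex ^ 'n}"
  by (auto simp: vec.span_singleton vector_scalar_commute image_iff)

lemma represents_matrix:
  fixes A :: "complex ^ 'n ^ 'n"
  assumes "represents E v L" "invertible A" "\<And>e. e \<in> E \<Longrightarrow> L' e = (*v) A ` L e"
  shows "represents E (\<lambda>e. A *v v e) L'"
proof -
  have "A *v x \<noteq> 0" if "x \<noteq> 0" for x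
    using assms(2) that by (metis invertible_left_inverse matrix_left_invertible_ker)
  then show ?thesis using assms by (simp add: represents_def image_span_singleton)
qed

lemma represents_realizes:
  assumes "represents E11 v L" "represents E11 w L" "realizes v" shows "realizes w"
proof -
  obtain c where c: "\<And>e. c e \<noteq> 0" "\<And>e. e \<in> E11 \<Longrightarrow> w e = c e *s v e"
    using represents_rescale[OF assms(1,2)] by blast
  have "realizes (\<lambda>e. c e *s v e)" using assms(3) by (simp add: realizes_scale c(1))
  then show ?thesis using realizes_cong[of w "\<lambda>e. c e *s v e", OF c(2)] by simp
qed

text \<open>The four-element subsets of \<open>E11\<close> are the ranges of injections from the
  index type, where \<open>arrangement_bases_iff\<close> trades bases for brackets of
  \<open>normal\<close>.\<close>

lemma realizations_iff:
  "L \<in> realizations E11 (arrangement_bases E11 \<A>) \<longleftrightarrow>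
     L \<in> proj_power E11 \<and> (\<forall>v. represents E11 v L \<longrightarrow> realizes v)"
proof -
  have "(\<forall>l\<subseteq>E11. card l = CARD(4) \<longrightarrow> (\<forall>v b. represents E11 v L \<and> bij_betw b (UNIV :: 4 set) l \<longrightarrow>
      (det (\<chi> i j. v (b j) $ i) \<noteq> 0 \<longleftrightarrow> l \<in> arrangement_bases E11 \<A>))) \<longleftrightarrow>
    (\<forall>v. represents E11 v L \<longrightarrow> realizes v)" (is "?l \<longleftrightarrow> ?r")
  proof
    assume l: ?l
    show ?r
      unfolding realizes_def
    proof (intro allI impI)
      fix v and b :: "4 \<Rightarrow> nat" assume v: "represents E11 v L" and b: "inj b" "range b \<subseteq> E11"
      have "card (range b) = CARD(4)" "bij_betw b UNIV (range b)"
        using b(1) by (simp_all add: card_image bij_betw_def)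
      then have "det (\<chi> i j. v (b j) $ i) \<noteq> 0 \<longleftrightarrow> range b \<in> arrangement_bases E11 \<A>"
        using l v b(2) by blast
      then show "bracket v b = 0 \<longleftrightarrow> bracket normal b = 0"
        using arrangement_bases_iff[OF b] unfolding bracket_def by blast
    qed
  next
    assume r: ?r
    show ?l
    proof (intro allI impI, elim conjE)
      fix l v and b :: "4 \<Rightarrow> nat"
      assume l: "l \<subseteq> E11" and v: "represents E11 v L" and "bij_betw b UNIV l"
      then have b: "inj b" "range b = l" by (auto simp: bij_betw_def)
      then have "bracket v b = 0 \<longleftrightarrow> bracket normal b = 0"
        using r v l unfolding realizes_def by blast
      then show "det (\<chi> i j. v (b j) $ i) \<noteq> 0 \<longleftrightarrow> l \<in> arrangement_bases E11 \<A>"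
        using arrangement_bases_iff[of b] b l unfolding bracket_def by blast
    qed
  qed
  then show ?thesis unfolding realizations_def by blast
qed

text \<open>In the coordinates for which 3, 4, 5, 2 are the basis and 6 is the unit point of the plane,
  the \<open>i\<close>-th parameter is the first (for \<open>i = 1, 2\<close>) or second coordinate of a point of
  index \<open>param_point i\<close> divided by its third coordinate.\<close>

definition param_point :: "5 \<Rightarrow> nat" where
  "param_point i = (if i = 1 then 10 else if i = 2 then 8 else if i = 3 then 7 else if i = 4 then 9 else 1)"

text \<open>Cramer's rule: replacing 3 or 4 by \<open>e\<close> in the basis 3, 4, 5, 2 gives the
  first or second coordinate of \<open>e\<close>, up to the bracket of the basis.\<close>

definition param_quad :: "5 \<Rightarrow> nat \<Rightarrow> 4 \<Rightarrow> nat" where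
  "param_quad i e = (if i = 1 \<or> i = 2 then quad e 4 5 2 else quad 3 e 5 2)"

text \<open>With \<open>param_den\<close>, the coordinate ratio of the chosen point is divided by
  the same ratio for 6. This cancels the scales of the basis vectors, as in a cross-ratio.\<close>

definition param_num :: "5 \<Rightarrow> (nat \<Rightarrow> complex ^ 4) \<Rightarrow> complex" where
  "param_num i v = bracket v (param_quad i (param_point i)) * bracket v (quad 3 4 6 2)"

definition param_den :: "5 \<Rightarrow> (nat \<Rightarrow> complex ^ 4) \<Rightarrow> complex" where
  "param_den i v = bracket v (param_quad i 6) * bracket v (quad 3 4 (param_point i) 2)"

definition params :: "(nat \<Rightarrow> complex ^ 4) \<Rightarrow> complex ^ 5" where
  "params v = (\<chi> i. param_num i v / param_den i v)"

definition param_degree :: "5 \<Rightarrow> nat \<Rightarrow> nat" where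
  "param_degree i e =
     (if e \<in> range (param_quad i (param_point i)) then 1 else 0) + (if e \<in> {3, 4, 6, 2} then 1 else 0)"

lemmas param_defs = param_point_def param_quad_def

lemma param_num_multihomogeneous: "param_num i \<in> multihomogeneous E11 (param_degree i)"
proof -
  have "inj (param_quad i (param_point i))" "range (param_quad i (param_point i)) \<subseteq> E11"
    using exhaust_5[of i] by (auto simp: param_defs)
  then have "(\<lambda>v. bracket v (param_quad i (param_point i)) * bracket v (quad 3 4 6 2)) \<in>
    multihomogeneous E11 (\<lambda>e. (if e \<in> range (param_quad i (param_point i)) then 1 else 0) +
      (if e \<in> range (quad 3 4 6 2) then 1 else 0))"
    by (intro multihomogeneous_mult bracket_multihomogeneous) auto
  then show ?thesis by (simp add: param_num_def[abs_def] param_degree_def[abs_def])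
qed

lemma param_den_multihomogeneous: "param_den i \<in> multihomogeneous E11 (param_degree i)"
proof -
  have "inj (param_quad i 6)" "range (param_quad i 6) \<subseteq> E11"
    "inj (quad 3 4 (param_point i) 2)" "range (quad 3 4 (param_point i) 2) \<subseteq> E11"
    using exhaust_5[of i] by (auto simp: param_defs)
  then have "(\<lambda>v. bracket v (param_quad i 6) * bracket v (quad 3 4 (param_point i) 2)) \<in>
    multihomogeneous E11 (\<lambda>e. (if e \<in> range (param_quad i 6) then 1 else 0) +
      (if e \<in> range (quad 3 4 (param_point i) 2) then 1 else 0))"
    by (intro multihomogeneous_mult bracket_multihomogeneous) auto
  \<comment> \<open>Passing from numerator to denominator, 6 and the chosen point trade places, so
    each label occurs equally often.\<close>
  moreover have "(\<lambda>e. (if e \<in> range (param_quad i 6) then 1 else 0) +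
      (if e \<in> range (quad 3 4 (param_point i) 2) then 1 else 0)) = param_degree i"
    using exhaust_5[of i] by (auto simp: param_defs param_degree_def fun_eq_iff)
  ultimately show ?thesis by (simp add: param_den_def[abs_def])
qed

lemma param_den_nonzero:
  assumes "realizes v" shows "param_den i v \<noteq> 0"
proof -
  have "bracket v b \<noteq> 0" if "bracket normal b \<noteq> 0" "inj b" "range b \<subseteq> E11" for b
    using assms that unfolding realizes_def by blast
  moreover have "bracket normal (param_quad i 6) \<noteq> 0"
    "bracket normal (quad 3 4 (param_point i) 2) \<noteq> 0"
    using exhaust_5[of i] by (auto simp: param_defs bracket_def det_4 normal_simps)
  moreover have "inj (param_quad i 6)" "range (param_quad i 6) \<subseteq> E11"
    "inj (quad 3 4 (param_point i) 2)" "range (quad 3 4 (param_point i) 2) \<subseteq> E11"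
    using exhaust_5[of i] by (auto simp: param_defs)
  ultimately show ?thesis unfolding param_den_def by simp
qed

lemma params_normal_form: "params (normal_form x) = x"
proof -
  have "param_num i (normal_form x) / param_den i (normal_form x) = x $ i" for i
    using exhaust_5[of i]
    by (auto simp: param_defs param_num_def param_den_def bracket_def det_4 normal_form_simps)
  then show ?thesis by (simp add: params_def vec_eq_iff)
qed

text \<open>The matrix contributes the square of its determinant to numerator and denominator, and
  the scalars contribute equal products since the degrees agree. With both in one hypothesis, the
  lemma covers a change of representatives, projective equivalence and passage to the normal
  form.\<close>

lemma params_projective:
  assumes A: "invertible A" and c: "\<And>e. e \<in> E11 \<Longrightarrow> c e \<noteq> 0"
    and w: "\<And>e. e \<in> E11 \<Longrightarrow> c e *s w e = A *v v e"
  shows "params w = params v"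
proof -
  have scale: "f w * (\<Prod>e\<in>E11. c e ^ d e) = f (\<lambda>e. A *v v e)" if "f \<in> multihomogeneous E11 d" for f d
  proof -
    have "f (\<lambda>e. c e *s w e) = f (\<lambda>e. A *v v e)"
    proof (rule polynomial_functions_cong[OF _ w])
      show "f \<in> polynomial_functions {\<lambda>v. v e $ i | e i. e \<in> E11}"
        using that unfolding multihomogeneous_def by blast
    qed
    then show ?thesis using that by (simp add: multihomogeneous_def mult.commute)
  qed
  have "param_num i w / param_den i w = param_num i v / param_den i v" for i
  proof -
    define C where "C = (\<Prod>e\<in>E11. c e ^ param_degree i e)"
    have "C \<noteq> 0" using c by (simp add: C_def del: atLeastAtMost_iff)
    moreover have "det A \<noteq> 0" using A by (simp add: invertible_det_nz)
    moreover have "param_num i w * C = det A * det A * param_num i v"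
      using scale[OF param_num_multihomogeneous[of i]]
      by (simp add: C_def param_num_def bracket_matrix mult_ac)
    moreover have "param_den i w * C = det A * det A * param_den i v"
      using scale[OF param_den_multihomogeneous[of i]]
      by (simp add: C_def param_den_def bracket_matrix mult_ac)
    ultimately show ?thesis
      by (metis mult_divide_mult_cancel_left mult_divide_mult_cancel_right no_zero_divisors)
  qed
  then show ?thesis by (simp add: params_def)
qed

lemma normal_form_affine_poly: "(\<lambda>x. normal_form x e $ j) \<in> affine_polys" if "e \<in> E11"
proof -
  have coord: "(\<lambda>x :: complex ^ 5. x $ i) \<in> polynomial_functions (range (\<lambda>i x. x $ i))" for i
    by (rule polynomial_functions.coord) blast
  show ?thesis
    using that exhaust_4[of j] unfolding mem_E11 affine_polys_def
    by (auto simp: normal_form_simps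
        intro!: polynomial_functions_diff polynomial_functions.mult polynomial_functions.const coord)
qed

lemma realizes_normal: "realizes normal"
  by (simp add: realizes_def)

text \<open>By \<open>bracket_normal_form_zero\<close> only nonvanishing at the finitely many
  listings of bases remains, and the product of these brackets is a single polynomial.\<close>

lemma realizes_normal_form_open:
  obtains g where "g \<in> affine_polys" "\<And>x. realizes (normal_form x) \<longleftrightarrow> g x \<noteq> 0"
proof -
  define F where "F = {b :: 4 \<Rightarrow> nat. inj b \<and> range b \<subseteq> E11 \<and> bracket normal b \<noteq> 0}"
  \<comment> \<open>The bound has the shape of \<open>finite_set_of_finite_funs\<close>, whose
    default value 0 would apply outside \<open>UNIV\<close>.\<close>
  have "F \<subseteq> {f. \<forall>x. (x \<in> UNIV \<longrightarrow> f x \<in> E11) \<and> (x \<notin> UNIV \<longrightarrow> f x = 0)}"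
    unfolding F_def by blast
  then have "finite F" by (rule finite_subset) (intro finite_set_of_finite_funs; simp)
  let ?g = "\<lambda>x. \<Prod>b\<in>F. bracket (normal_form x) b"
  have "(\<lambda>x. bracket (normal_form x) b) \<in> affine_polys" if "b \<in> F" for b
  proof (rule pullback_multihomogeneous)
    show "(\<lambda>v. bracket v b) \<in> multihomogeneous E11 (\<lambda>e. if e \<in> range b then 1 else 0)"
      using that unfolding F_def by (intro bracket_multihomogeneous) auto
  qed (rule normal_form_affine_poly)
  then have "?g \<in> affine_polys" unfolding affine_polys_def by (intro polynomial_functions_prod)
  moreover have "realizes (normal_form x) \<longleftrightarrow> ?g x \<noteq> 0" for x
    using \<open>finite F\<close> bracket_normal_form_zero[of _ x] unfolding realizes_def F_def by auto
  ultimately show ?thesis by (rule that)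
qed

theorem proposition4p2:
  shows "\<exists>U :: (complex ^ 5) set.
    openin affine_zariski U \<and>
    affine_zariski closure_of U = UNIV \<and>
    isomorphic
      (realization_space {1..11} (arrangement_bases {1..11} \<A>)
         :: (nat \<Rightarrow> (complex ^ 4) set) set space_with_functions)
      (affine_subspace U)"
proof -
  define U where "U = {x. realizes (normal_form x)}"
  let ?S = "realizations E11 (arrangement_bases E11 \<A>) :: (nat \<Rightarrow> (complex ^ 4) set) set"
  let ?r = "projective_equivalence E11 (arrangement_bases E11 \<A>) :: ((nat \<Rightarrow> (complex ^ 4) set) \<times> _) set"
  let ?\<sigma> = "\<lambda>x. \<lambda>e\<in>E11. vec.span {normal_form x e}"
  have normalize: "\<exists>A c x. invertible A \<and> (\<forall>e\<in>E11. c e \<noteq> 0 \<and> A *v v e = c e *s normal_form x e) \<and> x \<in> U"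
    if v: "realizes v" for v
  proof -
    obtain A c x where A: "invertible A" and c: "\<And>e. e \<in> E11 \<Longrightarrow> c e \<noteq> 0"
      and eq: "\<And>e. e \<in> E11 \<Longrightarrow> A *v v e = c e *s normal_form x e"
      by (rule normal_form_exists[OF v]) blast
    have "realizes (\<lambda>e. A *v v e)" using v by (simp add: realizes_matrix[OF A])
    then have "realizes (\<lambda>e. c e *s normal_form x e)"
      using realizes_cong[of "\<lambda>e. A *v v e" "\<lambda>e. c e *s normal_form x e", OF eq] by simp
    then have "x \<in> U" using realizes_scale[OF c] by (simp add: U_def)
    then show ?thesis using A c eq by blast
  qed
  obtain g where g: "g \<in> affine_polys" "\<And>x. realizes (normal_form x) \<longleftrightarrow> g x \<noteq> 0"
    by (rule realizes_normal_form_open) blast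
  then have U: "U = {x. g x \<noteq> 0}" by (simp add: U_def)
  have "openin affine_zariski U"
    unfolding openin_affine_zariski U using g(1) by (intro exI[of _ "{g}"]) auto
  moreover have "affine_zariski closure_of U = UNIV"
  proof -
    \<comment> \<open>The given arrangement realizes its own matroid, so its normal form supplies a
      point of \<open>U\<close>.\<close>
    obtain x where "x \<in> U" using normalize[OF realizes_normal] by blast
    then show ?thesis using affine_zariski_dense[OF g(1)] U by blast
  qed
  moreover have "isomorphic (realization_space E11 (arrangement_bases E11 \<A>)
      :: (nat \<Rightarrow> (complex ^ 4) set) set space_with_functions) (affine_subspace U)"
  proof (rule isomorphic_realization_space)
    let ?\<Phi> = "\<lambda>L. params (SOME v. represents E11 v L)"
    have \<Phi>: "?\<Phi> L = params v" if v: "represents E11 v L" for L v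
    proof -
      have r: "represents E11 (SOME v. represents E11 v L) L" by (rule someI[of "\<lambda>v. represents E11 v L", OF v])
      obtain c where c: "\<And>e. c e \<noteq> 0"
        "\<And>e. e \<in> E11 \<Longrightarrow> v e = c e *s (SOME v. represents E11 v L) e"
        using represents_rescale[OF r v] by blast
      show ?thesis
        by (rule params_projective[of "mat 1" c]) (use c in \<open>auto simp: invertible_def\<close>)
    qed
    show "param_num i \<in> multihomogeneous E11 (param_degree i)"
      "param_den i \<in> multihomogeneous E11 (param_degree i)" for i
      by (rule param_num_multihomogeneous param_den_multihomogeneous)+
    show "param_den i v \<noteq> 0 \<and> ?\<Phi> L $ i = param_num i v / param_den i v"
      if "L \<in> ?S" "represents E11 v L" for L v i
    proof -
      have "realizes v" using that unfolding realizations_iff by blast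
      then show ?thesis unfolding \<Phi>[OF that(2)] by (simp add: params_def param_den_nonzero)
    qed
    show "?\<Phi> L = ?\<Phi> L'" if LL: "(L, L') \<in> ?r" for L L'
    proof -
      obtain A :: "complex ^ 4 ^ 4" where L: "L \<in> ?S" and A: "invertible A"
        "\<And>e. e \<in> E11 \<Longrightarrow> L' e = (*v) A ` L e"
        using LL unfolding projective_equivalence_def by blast
      obtain v where v: "represents E11 v L"
        using L by (auto simp only: realizations_iff elim: proj_power_represents)
      have "params (\<lambda>e. A *v v e) = params v"
        using A(1) by (rule params_projective[of A "\<lambda>_. 1"]) auto
      then show ?thesis using \<Phi>[OF v] \<Phi>[OF represents_matrix[OF v A]] by simp
    qed
    show "(\<lambda>x. normal_form x e $ j) \<in> affine_polys" if "e \<in> E11" for e j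
      using that by (rule normal_form_affine_poly)
    show s0: "normal_form x e \<noteq> 0" if "x \<in> U" "e \<in> E11" for x e
    proof -
      \<comment> \<open>Every other point has a coordinate equal to 1; only 11 could be zero, and
        its membership in a basis excludes this.\<close>
      have "bracket (normal_form x) (quad 3 11 5 2) \<noteq> 0"
        using realizes_quad[of "normal_form x" 3 11 5 2] that
        by (simp add: U_def bracket_def det_4 normal_simps)
      then have "normal_form x 11 \<noteq> 0" by (auto simp: bracket_def det_4)
      then show ?thesis
        using that(2) unfolding mem_E11
        by (auto simp: vec_eq_iff forall_4 normal_form_simps simp del: not_all)
    qed
    have rep: "represents E11 (normal_form x) (?\<sigma> x)" if "x \<in> U" for x
      using s0[OF that] by (simp add: represents_def)
    have \<sigma>: "?\<sigma> x \<in> ?S" if "x \<in> U" for x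
    proof -
      have "?\<sigma> x \<in> proj_power E11"
        using s0[OF that] by (auto simp: proj_power_def proj_space_def)
      then show ?thesis
        unfolding realizations_iff
        using that represents_realizes[OF rep[OF that]] by (auto simp: U_def)
    qed
    show "?\<sigma> x \<in> ?S \<and> ?\<Phi> (?\<sigma> x) = x" if "x \<in> U" for x
      using \<sigma>[OF that] \<Phi>[OF rep[OF that]] params_normal_form by simp
    show "?\<Phi> L \<in> U \<and> (L, ?\<sigma> (?\<Phi> L)) \<in> ?r" if L: "L \<in> ?S" for L
    proof -
      obtain v where v: "represents E11 v L"
        using L by (auto simp only: realizations_iff elim: proj_power_represents)
      then have v': "realizes v" using L unfolding realizations_iff by blast
      obtain A c x where A: "invertible A" and x: "x \<in> U"
        and c: "\<And>e. e \<in> E11 \<Longrightarrow> c e \<noteq> 0" "\<And>e. e \<in> E11 \<Longrightarrow> A *v v e = c e *s normal_form x e"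
        using normalize[OF v'] by blast
      have "params (normal_form x) = params v"
        using A c(1) c(2)[symmetric] by (rule params_projective)
      then have \<Phi>x: "?\<Phi> L = x" using \<Phi>[OF v] params_normal_form by simp
      \<comment> \<open>The scalars \<open>c e\<close> disappear in the spans, so \<open>A\<close>
        alone carries \<open>L\<close> to its normal form.\<close>
      have "?\<sigma> x e = (*v) A ` L e" if "e \<in> E11" for e
        using v c[OF that] that
        by (simp add: represents_def image_span_singleton span_scale_singleton del: atLeastAtMost_iff)
      then have "(L, ?\<sigma> x) \<in> ?r"
        using L \<sigma>[OF x] A unfolding projective_equivalence_def by blast
      then show ?thesis using \<Phi>x x by simp
    qed
  qed
  ultimately show ?thesis by blast
qed

end
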